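(* Let $T$ be a tree on $n\geq 4$ vertices. Then the eccentricity matrix $\mathcal{E}(T)$ has exactly three distinct eigenvalues if and only if $T$ is the star $K_{1,n-1}$.
   Context: For a connected graph $G$ with distance function $d(u,v)$, the eccentricity of a vertex $u$ is $e(u)=\max_{v}d(u,v)$. The eccentricity matrix $\mathcal{E}(G)$ is the matrix indexed by $V(G)$ with $\mathcal{E}(G)_{uv}=d(u,v)$ if $d(u,v)=\min\{e(u),e(v)\}$, and $\mathcal{E}(G)_{uv}=0$ otherwise. *)

theory Defs
  imports "Graph_Theory.Graph_Theory" "Jordan_Normal_Form.Spectral_Radius"
begin

text \<open>
  A finite simple undirected graph is a structure satisfying the locale predicate \<open>graph\<close>:
  a finite, symmetric, loop-free digraph without parallel arcs.

  The predicates \<open>forest\<close> and \<open>tree\<close> of the library are unsuitable for such graphs: an edge of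
  the undirected graph is a pair of opposite arcs, and these form a directed cycle of length 2.
  The cycles of the undirected graph are the directed cycles of length at least 3.
\<close>

definition undirected_tree :: "('a, 'b) pre_digraph \<Rightarrow> bool" where
  "undirected_tree G \<longleftrightarrow> graph G \<and> Digraph_Component.connected G \<and>
     \<not> (\<exists>c. pre_digraph.cycle G c \<and> 3 \<le> length c)"

text \<open>
  The shortest-path distance with unit arc weights. The library's \<open>\<mu>\<close> takes values in the
  extended reals; it is finite for vertices of a connected graph.
\<close>

definition gdist :: "('a, 'b) pre_digraph \<Rightarrow> 'a \<Rightarrow> 'a \<Rightarrow> real" where
  "gdist G u v = real_of_ereal (wf_digraph.\<mu> G (\<lambda>_. 1) u v)"

lemma gdist_eq_Least:
  assumes "wf_digraph G" and p: "pre_digraph.awalk G u p v"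
  shows "gdist G u v = real (LEAST k. \<exists>q. pre_digraph.awalk G u q v \<and> length q = k)"
proof -
  interpret wf_digraph G by fact
  let ?P = "\<lambda>k. \<exists>q. awalk u q v \<and> length q = k"
  let ?k = "LEAST k. ?P k"
  have cost: "awalk_cost (\<lambda>_. 1) q = real (length q)" for q
    by (induct q) simp_all
  have "?P (length p)" using p by blast
  from LeastI[of ?P, OF this] obtain q where q: "awalk u q v" "length q = ?k" by blast
  have "\<mu> (\<lambda>_. 1) u v = ereal (real ?k)"
    unfolding \<mu>_def
  proof (rule antisym)
    show "(INF p\<in>{p. awalk u p v}. ereal (awalk_cost (\<lambda>_. 1) p)) \<le> ereal (real ?k)"
      using q by (intro INF_lower2[of q]) (simp_all add: cost)
  next
    show "ereal (real ?k) \<le> (INF p\<in>{p. awalk u p v}. ereal (awalk_cost (\<lambda>_. 1) p))"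
      by (rule INF_greatest) (auto simp: cost intro: Least_le)
  qed
  then show ?thesis by (simp add: gdist_def)
qed

definition eccentricity :: "('a, 'b) pre_digraph \<Rightarrow> 'a \<Rightarrow> real" where
  "eccentricity G u = Max (gdist G u ` verts G)"

text \<open>
  A matrix indexed by the vertex set is represented by a matrix whose rows and columns follow
  an enumeration \<open>vs\<close> of the vertices. Different enumerations give permutation-similar matrices.
\<close>

definition eccentricity_matrix :: "('a, 'b) pre_digraph \<Rightarrow> 'a list \<Rightarrow> real mat" where
  "eccentricity_matrix G vs = mat (length vs) (length vs) (\<lambda>(i, j).
     let u = vs ! i; v = vs ! j in
     if gdist G u v = min (eccentricity G u) (eccentricity G v) then gdist G u v else 0)"

end

theory Submission
  imports Defs
begin

text \<open>
  A real symmetric matrix \<open>E\<close> with three distinct eigenvalues satisfies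
  \<open>E\<^sup>3 = s E\<^sup>2 + t E + w I\<close>. For a tree of diameter at least 3 this relation is contradicted by
  comparing a few entries.

  If the diameter is \<open>2k + 1\<close> with central edge \<open>xy\<close>, then \<open>E\<close> has nonzero entries only between the
  two sides of \<open>xy\<close>, so \<open>E\<^sup>2\<close> vanishes at \<open>(x, y)\<close>; so does \<open>E\<close>, but the path \<open>x b a y\<close> through the
  ends of a diametral path shows \<open>E\<^sup>3\<close> to be positive there.

  If the diameter is \<open>2k\<close> with \<open>k \<ge> 2\<close> and centre \<open>c\<close>, the row of \<open>c\<close> is \<open>k\<close> times the indicator of the
  set \<open>P\<close> of vertices at distance \<open>k\<close> from \<open>c\<close>, and the row of a neighbour \<open>x\<close> of \<open>c\<close> is \<open>k + 1\<close> times
  the indicator of the set \<open>Q\<close> of those vertices of \<open>P\<close> that are not in the branch of \<open>x\<close>. A combination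
  of these rows vanishes, so \<open>w = 0\<close>. The entries at \<open>(c, x)\<close> and \<open>(x, x)\<close> now both give \<open>s |Q|\<close>, for
  the sums of \<open>E\<close> over \<open>P \<times> Q\<close> and over \<open>Q \<times> Q\<close>; but these differ by the positive sum over
  \<open>(P - Q) \<times> Q\<close>.
\<close>

section \<open>Symmetric kernels with three eigenvalues\<close>

definition kernel_shift :: "'a set \<Rightarrow> ('a \<Rightarrow> 'a \<Rightarrow> 'k) \<Rightarrow> 'k \<Rightarrow> ('a \<Rightarrow> 'k) \<Rightarrow> 'a \<Rightarrow> 'k::comm_ring_1" where
  "kernel_shift V K b f u = (\<Sum>v\<in>V. K u v * f v) - b * f u"

definition kernel_eigenvalue :: "'a set \<Rightarrow> ('a \<Rightarrow> 'a \<Rightarrow> 'k) \<Rightarrow> 'k::comm_ring_1 \<Rightarrow> bool" where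
  "kernel_eigenvalue V K b \<longleftrightarrow> (\<exists>f. (\<exists>v\<in>V. f v \<noteq> 0) \<and> (\<forall>u\<in>V. (\<Sum>v\<in>V. K u v * f v) = b * f u))"

section \<open>Products of the commuting operators \<open>K - b\<close>\<close>

lemma kernel_shift_commute: "kernel_shift V K a (kernel_shift V K b f) = kernel_shift V K b (kernel_shift V K a f)"
  by (rule ext) (simp add: kernel_shift_def algebra_simps sum_subtractf sum_distrib_left)

lemma kernel_shift_cong:
  "u \<in> V \<Longrightarrow> (\<And>v. v \<in> V \<Longrightarrow> f v = g v) \<Longrightarrow> kernel_shift V K b f u = kernel_shift V K b g u"
  by (simp add: kernel_shift_def)

lemma kernel_shift_eq_0:
  "u \<in> V \<Longrightarrow> (\<And>v. v \<in> V \<Longrightarrow> f v = 0) \<Longrightarrow> kernel_shift V K b f u = 0"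
  by (simp add: kernel_shift_def)

lemma fold_kernel_shift_cong:
  "u \<in> V \<Longrightarrow> (\<And>v. v \<in> V \<Longrightarrow> f v = g v) \<Longrightarrow> fold (kernel_shift V K) bs f u = fold (kernel_shift V K) bs g u"
proof (induction bs arbitrary: f g)
  case (Cons b bs)
  have "kernel_shift V K b f v = kernel_shift V K b g v" if "v \<in> V" for v
    using that Cons.prems(2) by (rule kernel_shift_cong)
  with Cons.IH[of "kernel_shift V K b f" "kernel_shift V K b g"] Cons.prems(1) show ?case by simp
qed simp

lemma kernel_shift_sum:
  "kernel_shift V K b (\<lambda>u. \<Sum>j\<in>J. c j * f j u) u = (\<Sum>j\<in>J. c j * kernel_shift V K b (f j) u)"
proof -
  have "(\<Sum>v\<in>V. K u v * (\<Sum>j\<in>J. c j * f j v)) = (\<Sum>j\<in>J. \<Sum>v\<in>V. K u v * (c j * f j v))"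
    by (subst sum.swap) (simp add: sum_distrib_left)
  then show ?thesis
    by (simp add: kernel_shift_def sum_subtractf right_diff_distrib sum_distrib_left mult.left_commute)
qed

lemma fold_kernel_shift_sum:
  "fold (kernel_shift V K) bs (\<lambda>u. \<Sum>j\<in>J. c j * f j u) u = (\<Sum>j\<in>J. c j * fold (kernel_shift V K) bs (f j) u)"
proof (induction bs arbitrary: f u)
  case (Cons b bs)
  have "kernel_shift V K b (\<lambda>u. \<Sum>j\<in>J. c j * f j u) = (\<lambda>u. \<Sum>j\<in>J. c j * kernel_shift V K b (f j) u)"
    by (rule ext) (rule kernel_shift_sum)
  then show ?case using Cons.IH[of "\<lambda>j. kernel_shift V K b (f j)"] by simp
qed simp

lemma fold_kernel_shift_commute:
  "fold (kernel_shift V K) bs (kernel_shift V K a f) = kernel_shift V K a (fold (kernel_shift V K) bs f)"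
proof (induction bs arbitrary: f)
  case (Cons b bs)
  then show ?case using Cons.IH[of "kernel_shift V K b f"] by (simp add: kernel_shift_commute[of V K a b f])
qed simp

text \<open>As the factors commute, any one of them can be moved to the end, so the result of the
  whole product lies in the range of each \<open>K - b\<close>.\<close>

lemma fold_kernel_shift_split:
  "b \<in> set bs \<Longrightarrow> \<exists>g. fold (kernel_shift V K) bs f = kernel_shift V K b g"
proof (induction bs arbitrary: f)
  case (Cons a bs)
  show ?case
  proof (cases "b \<in> set bs")
    case False
    then have "b = a" using Cons.prems by simp
    then show ?thesis by (auto simp: fold_kernel_shift_commute)
  qed (use Cons.IH in auto)
qed simp

text \<open>Apply the factors one at a time: the vector just before the first factor that makes it
  vanish on \<open>V\<close> is an eigenvector for that factor.\<close>

lemma fold_kernel_shift_eigenvector: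
  assumes "v \<in> V" "f v \<noteq> 0" "\<And>u. u \<in> V \<Longrightarrow> fold (kernel_shift V K) bs f u = 0"
  shows "\<exists>xs b ys. bs = xs @ b # ys \<and> (\<exists>u\<in>V. fold (kernel_shift V K) xs f u \<noteq> 0) \<and>
    (\<forall>u\<in>V. kernel_shift V K b (fold (kernel_shift V K) xs f) u = 0)"
  using assms
proof (induction bs arbitrary: f v)
  case (Cons b bs)
  show ?case
  proof (cases "\<forall>u\<in>V. kernel_shift V K b f u = 0")
    case True
    then have "b # bs = [] @ b # bs \<and> (\<exists>u\<in>V. fold (kernel_shift V K) [] f u \<noteq> 0) \<and>
      (\<forall>u\<in>V. kernel_shift V K b (fold (kernel_shift V K) [] f) u = 0)"
      using Cons.prems by auto
    then show ?thesis by blast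
  next
    case False
    then obtain w where "w \<in> V" "kernel_shift V K b f w \<noteq> 0" by blast
    from Cons.IH[of w "kernel_shift V K b f", OF this] Cons.prems(3) obtain xs c ys where
      "bs = xs @ c # ys" "\<exists>u\<in>V. fold (kernel_shift V K) xs (kernel_shift V K b f) u \<noteq> 0"
      "\<forall>u\<in>V. kernel_shift V K c (fold (kernel_shift V K) xs (kernel_shift V K b f)) u = 0"
      by auto
    then have "b # bs = (b # xs) @ c # ys \<and> (\<exists>u\<in>V. fold (kernel_shift V K) (b # xs) f u \<noteq> 0) \<and>
      (\<forall>u\<in>V. kernel_shift V K c (fold (kernel_shift V K) (b # xs) f) u = 0)" by simp
    then show ?thesis by blast
  qed
qed simp

section \<open>From matrices to kernels, and a Cayley-Hamilton argument\<close>

lemma sum_nth_distinct: "distinct vs \<Longrightarrow> (\<Sum>v\<in>set vs. g v) = (\<Sum>i<length vs. g (vs ! i))"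
  by (intro sum.reindex_bij_betw[symmetric] bij_betw_nth) auto

text \<open>Eigenvectors indexed by positions in \<open>vs\<close> correspond to functions on the
  vertices. This removes the enumeration from all later arguments.\<close>

lemma eigenvalue_mat_iff_kernel_eigenvalue:
  fixes K :: "'a \<Rightarrow> 'a \<Rightarrow> 'k::field"
  assumes "distinct vs"
  shows "eigenvalue (mat (length vs) (length vs) (\<lambda>(i, j). K (vs ! i) (vs ! j))) b
    \<longleftrightarrow> kernel_eigenvalue (set vs) K b"
proof -
  let ?n = "length vs" and ?A = "mat (length vs) (length vs) (\<lambda>(i, j). K (vs ! i) (vs ! j))"
  note sum = sum_nth_distinct[OF assms]
  have row: "(?A *\<^sub>v x) $ i = (\<Sum>j<?n. K (vs ! i) (vs ! j) * x $ j)"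
    if "i < ?n" "x \<in> carrier_vec ?n" for i x
    using that by (auto simp: scalar_prod_def lessThan_atLeast0 intro!: sum.cong)
  show ?thesis
  proof
    assume "eigenvalue ?A b"
    then obtain x where x: "x \<in> carrier_vec ?n" "x \<noteq> 0\<^sub>v ?n" "?A *\<^sub>v x = b \<cdot>\<^sub>v x"
      unfolding eigenvalue_def eigenvector_def by auto
    \<comment> \<open>Distinctness of \<open>vs\<close> makes the position unique, so the
      description operator inverts the enumeration.\<close>
    define f where "f v = x $ (THE i. i < ?n \<and> vs ! i = v)" for v
    have f: "f (vs ! i) = x $ i" if "i < ?n" for i
    proof -
      have "(THE j. j < ?n \<and> vs ! j = vs ! i) = i"
        using that assms by (auto simp: nth_eq_iff_index_eq)
      then show ?thesis by (simp add: f_def)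
    qed
    obtain i where "i < ?n" "x $ i \<noteq> 0" using x(1,2) by (auto simp: vec_eq_iff)
    then have "\<exists>v\<in>set vs. f v \<noteq> 0" using f by (metis nth_mem)
    moreover have "(\<Sum>v\<in>set vs. K u v * f v) = b * f u" if u: "u \<in> set vs" for u
    proof -
      obtain i where i: "i < ?n" "u = vs ! i" using u by (auto simp: in_set_conv_nth)
      then show ?thesis using row[OF i(1) x(1)] x(1,3) by (simp add: sum f)
    qed
    ultimately show "kernel_eigenvalue (set vs) K b" unfolding kernel_eigenvalue_def by blast
  next
    assume "kernel_eigenvalue (set vs) K b"
    then obtain f v where f: "v \<in> set vs" "f v \<noteq> 0"
      "\<And>u. u \<in> set vs \<Longrightarrow> (\<Sum>v\<in>set vs. K u v * f v) = b * f u"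
      unfolding kernel_eigenvalue_def by blast
    define x where "x = vec ?n (\<lambda>i. f (vs ! i))"
    obtain i where "i < ?n" "vs ! i = v" using f(1) by (auto simp: in_set_conv_nth)
    then have "x \<noteq> 0\<^sub>v ?n" using f(2) by (auto simp: x_def vec_eq_iff)
    moreover have "?A *\<^sub>v x = b \<cdot>\<^sub>v x"
    proof (rule eq_vecI)
      fix i assume "i < dim_vec (b \<cdot>\<^sub>v x)"
      then have i: "i < ?n" by (simp add: x_def)
      show "(?A *\<^sub>v x) $ i = (b \<cdot>\<^sub>v x) $ i"
        using row[OF i, of x] f(3)[of "vs ! i"] i by (simp add: x_def sum)
    qed (simp add: x_def)
    ultimately show "eigenvalue ?A b"
      unfolding eigenvalue_def eigenvector_def by (auto simp: x_def intro!: exI[of _ x])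
  qed
qed

text \<open>A Schur decomposition makes \<open>K\<close> upper triangular, and the product of
  \<open>K - b\<close> over its diagonal entries, taken with multiplicity, is zero.\<close>

lemma kernel_annihilated_by_eigenvalues:
  fixes K :: "'a \<Rightarrow> 'a \<Rightarrow> complex"
  assumes "finite V"
  shows "\<exists>bs. set bs \<subseteq> Collect (kernel_eigenvalue V K) \<and>
    (\<forall>f. \<forall>u\<in>V. fold (kernel_shift V K) bs f u = 0)"
proof -
  obtain vs where vs: "set vs = V" "distinct vs" using finite_distinct_list[OF assms] by blast
  let ?n = "length vs"
  define A where "A = mat ?n ?n (\<lambda>(i, j). K (vs ! i) (vs ! j))"
  have A: "A \<in> carrier_mat ?n ?n" by (simp add: A_def)
  from char_poly_factorized[OF A] obtain es where es: "char_poly A = (\<Prod>a\<leftarrow>es. [:- a, 1:])" "length es = ?n"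
    by blast
  obtain B P Q where "schur_decomposition A es = (B, P, Q)" by (cases "schur_decomposition A es")
  from schur_decomposition[OF A es(1) this]
  have sim: "similar_mat_wit A B P Q" and ut: "upper_triangular B" and diag: "diag_mat B = es" by auto
  from similar_mat_witD2[OF A sim] have carr: "B \<in> carrier_mat ?n ?n" "P \<in> carrier_mat ?n ?n" "Q \<in> carrier_mat ?n ?n"
    and PQ: "P * Q = 1\<^sub>m ?n" and QP: "Q * P = 1\<^sub>m ?n" and APBQ: "A = P * B * Q" by auto
  have AP: "A * P = P * B"
    using carr by (simp add: APBQ assoc_mult_mat[of _ ?n ?n _ ?n _ ?n] QP)
  define ix where "ix v = (THE i. i < ?n \<and> vs ! i = v)" for v
  have ix: "ix (vs ! i) = i" if "i < ?n" for i
    using that vs(2) by (auto simp: ix_def nth_eq_iff_index_eq)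
  \<comment> \<open>The columns of \<open>P\<close>: triangularity sends \<open>p j\<close> under \<open>K - es ! j\<close> into the span of the earlier ones.\<close>
  define p where "p j v = P $$ (ix v, j)" for j v
  have es_nth: "es ! j = B $$ (j, j)" if "j < ?n" for j
    using that diag carr(1) by (auto simp: diag_mat_def)
  have shift: "kernel_shift V K (es ! j) (p j) u = (\<Sum>l<j. B $$ (l, j) * p l u)"
    if "j < ?n" "u \<in> V" for j u
  proof -
    obtain i where i: "i < ?n" "u = vs ! i" using \<open>u \<in> V\<close> by (auto simp: in_set_conv_nth simp flip: vs(1))
    have "(\<Sum>v\<in>V. K u v * p j v) = (\<Sum>l<?n. A $$ (i, l) * P $$ (l, j))"
      using i by (simp add: sum_nth_distinct vs(2) flip: vs(1)) (auto simp: p_def ix A_def intro!: sum.cong)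
    also have "\<dots> = (A * P) $$ (i, j)"
      using i that carr A by (auto simp: scalar_prod_def lessThan_atLeast0 intro!: sum.cong)
    also have "\<dots> = (\<Sum>l<?n. P $$ (i, l) * B $$ (l, j))"
      using i that carr by (auto simp: AP scalar_prod_def lessThan_atLeast0 intro!: sum.cong)
    also have "\<dots> = (\<Sum>l\<le>j. P $$ (i, l) * B $$ (l, j))"
      using that ut carr by (intro sum.mono_neutral_right) (auto simp: upper_triangular_def)
    also have "\<dots> = (\<Sum>l<j. B $$ (l, j) * p l u) + es ! j * p j u"
      using i that by (simp add: p_def ix es_nth mult.commute flip: lessThan_Suc_atMost)
    finally show ?thesis by (simp add: kernel_shift_def)
  qed
  \<comment> \<open>Induction on \<open>k\<close>. For the new column, let its own factor act first:
    what remains is a combination of earlier columns, which the first \<open>k\<close> factors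
    kill.\<close>
  have kill: "fold (kernel_shift V K) (take k es) (p j) u = 0" if "j < k" "k \<le> ?n" "u \<in> V" for j k u
    using that
  proof (induction k arbitrary: j u)
    case (Suc k)
    have take: "take (Suc k) es = take k es @ [es ! k]"
      using Suc.prems es(2) by (simp add: take_Suc_conv_app_nth)
    show ?case
    proof (cases "j = k")
      case True
      have "fold (kernel_shift V K) (take k es) (kernel_shift V K (es ! k) (p k)) u
          = fold (kernel_shift V K) (take k es) (\<lambda>u. \<Sum>l<k. B $$ (l, k) * p l u) u"
        using Suc.prems by (intro fold_kernel_shift_cong) (auto intro!: shift)
      also have "\<dots> = 0" using Suc by (simp add: fold_kernel_shift_sum)
      finally show ?thesis by (simp add: take True fold_kernel_shift_commute)
    next
      case False
      then have "\<forall>v\<in>V. fold (kernel_shift V K) (take k es) (p j) v = 0" using Suc by simp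
      then show ?thesis using Suc.prems by (simp add: take kernel_shift_eq_0)
    qed
  qed simp
  have "fold (kernel_shift V K) es f u = 0" if "u \<in> V" for f u
  proof -
    \<comment> \<open>Since \<open>P\<close> is invertible with inverse \<open>Q\<close>, every
      function on \<open>V\<close> is a combination of the columns of \<open>P\<close>, with
      coefficient vector \<open>Q *\<^sub>v x\<close>.\<close>
    define x where "x = vec ?n (\<lambda>i. f (vs ! i))"
    have x: "x \<in> carrier_vec ?n" by (simp add: x_def)
    have "f v = (\<Sum>j<?n. (Q *\<^sub>v x) $ j * p j v)" if v: "v \<in> V" for v
    proof -
      obtain i where i: "i < ?n" "v = vs ! i" using v by (auto simp: in_set_conv_nth simp flip: vs(1))
      have "x = P *\<^sub>v (Q *\<^sub>v x)"
        using carr x PQ by (metis assoc_mult_mat_vec one_mult_mat_vec)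
      then have "f v = (P *\<^sub>v (Q *\<^sub>v x)) $ i" using i by (simp add: x_def)
      also have "\<dots> = (\<Sum>j<?n. (Q *\<^sub>v x) $ j * p j v)"
        using i carr by (auto simp: scalar_prod_def lessThan_atLeast0 p_def ix intro!: sum.cong)
      finally show ?thesis .
    qed
    then have "fold (kernel_shift V K) es f u = fold (kernel_shift V K) es (\<lambda>v. \<Sum>j<?n. (Q *\<^sub>v x) $ j * p j v) u"
      using that by (intro fold_kernel_shift_cong)
    then show ?thesis using kill[of _ ?n u] that es(2) by (simp add: fold_kernel_shift_sum)
  qed
  moreover have "kernel_eigenvalue V K b" if "b \<in> set es" for b
  proof -
    have "poly (char_poly A) b = 0"
      using that by (auto simp: es(1) poly_prod_list prod_list_zero_iff o_def)
    then have "eigenvalue A b" using eigenvalue_root_char_poly[OF A] by blast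
    then show ?thesis using eigenvalue_mat_iff_kernel_eigenvalue[OF vs(2), of K b] vs(1) by (simp add: A_def)
  qed
  ultimately show ?thesis by blast
qed

section \<open>Real symmetric kernels: self-adjointness, real eigenvalues, and the cubic
  relation\<close>

context
  fixes V :: "'a set" and K :: "'a \<Rightarrow> 'a \<Rightarrow> real" and KC :: "'a \<Rightarrow> 'a \<Rightarrow> complex"
  assumes sym: "\<And>u v. u \<in> V \<Longrightarrow> v \<in> V \<Longrightarrow> K u v = K v u"
  defines "KC \<equiv> \<lambda>u v. of_real (K u v)"
begin

lemma kernel_shift_adjoint:
  "(\<Sum>u\<in>V. kernel_shift V KC b f u * cnj (g u)) = (\<Sum>u\<in>V. f u * cnj (kernel_shift V KC (cnj b) g u))"
proof -
  have "(\<Sum>u\<in>V. (\<Sum>v\<in>V. KC u v * f v) * cnj (g u)) = (\<Sum>v\<in>V. \<Sum>u\<in>V. KC u v * f v * cnj (g u))"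
    by (subst sum.swap) (simp add: sum_distrib_right)
  also have "\<dots> = (\<Sum>v\<in>V. f v * (\<Sum>u\<in>V. KC v u * cnj (g u)))"
    by (intro sum.cong) (auto simp: sum_distrib_left KC_def sym intro!: sum.cong)
  finally show ?thesis
    by (simp add: kernel_shift_def left_diff_distrib right_diff_distrib sum_subtractf KC_def mult.commute mult.left_commute)
qed

lemma sum_mult_cnj_eq_0:
  assumes "finite V" "(\<Sum>u\<in>V. g u * cnj (g u)) = (0::complex)" "u \<in> V"
  shows "g u = 0"
proof -
  have "of_real (\<Sum>u\<in>V. (cmod (g u))\<^sup>2) = (\<Sum>u\<in>V. g u * cnj (g u))"
    by (simp flip: complex_norm_square)
  then have "(\<Sum>u\<in>V. (cmod (g u))\<^sup>2) = 0" using assms(2) by (metis of_real_eq_0_iff)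
  then show ?thesis using assms(1,3) by (simp add: sum_nonneg_eq_0_iff)
qed

text \<open>Moving \<open>K - b\<close> across the inner product of an eigenvector with itself
  leaves a multiple of its squared norm by the conjugate of \<open>b - cnj b\<close>. Reality makes
  \<open>K - b\<close> self-adjoint and later gives the cubic real coefficients.\<close>

lemma kernel_eigenvalue_real:
  assumes "finite V" "kernel_eigenvalue V KC b"
  shows "cnj b = b"
proof -
  obtain f v where f: "v \<in> V" "f v \<noteq> 0" "\<And>u. u \<in> V \<Longrightarrow> kernel_shift V KC b f u = 0"
    using assms(2) unfolding kernel_eigenvalue_def kernel_shift_def by auto
  have shift: "kernel_shift V KC (cnj b) f u = (b - cnj b) * f u" if "u \<in> V" for u
    using f(3)[OF that] by (simp add: kernel_shift_def algebra_simps)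
  have "0 = (\<Sum>u\<in>V. f u * cnj (kernel_shift V KC (cnj b) f u))"
    using f(3) by (simp flip: kernel_shift_adjoint)
  also have "\<dots> = cnj (b - cnj b) * (\<Sum>u\<in>V. f u * cnj (f u))"
    by (simp add: shift sum_distrib_left mult.left_commute)
  finally have "cnj (b - cnj b) = 0 \<or> (\<Sum>u\<in>V. f u * cnj (f u)) = 0" by (metis mult_eq_0_iff)
  then show ?thesis using sum_mult_cnj_eq_0[OF assms(1) _ f(1)] f(2) by auto
qed

text \<open>
  For a self-adjoint operator, a vector that is both in the kernel and in the range of \<open>K - b\<close>
  vanishes; hence each eigenvalue is needed only once in an annihilating product.
\<close>

lemma symmetric_kernel_annihilated:
  assumes fin: "finite V" and ms: "set ms = Collect (kernel_eigenvalue V KC)" and "u \<in> V"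
  shows "fold (kernel_shift V KC) ms f u = 0"
proof (rule ccontr)
  let ?h = "fold (kernel_shift V KC) ms f"
  assume "?h u \<noteq> 0"
  \<comment> \<open>The list \<open>bs\<close> may repeat eigenvalues. Were \<open>?h\<close>
    nonzero, applying the factors of \<open>bs\<close> to it would reach an eigenvector
    \<open>?g\<close>, which also lies in the range of \<open>K - b\<close> because \<open>b\<close>
    occurs in \<open>ms\<close>.\<close>
  obtain bs where bs: "set bs \<subseteq> Collect (kernel_eigenvalue V KC)"
    "\<And>f u. u \<in> V \<Longrightarrow> fold (kernel_shift V KC) bs f u = 0"
    using kernel_annihilated_by_eigenvalues[OF fin] by meson
  from fold_kernel_shift_eigenvector[of u V ?h KC bs, OF \<open>u \<in> V\<close> \<open>?h u \<noteq> 0\<close> bs(2)] obtain xs b ys w where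
    b: "bs = xs @ b # ys" and w: "w \<in> V" "fold (kernel_shift V KC) xs ?h w \<noteq> 0"
    and ker: "\<And>u. u \<in> V \<Longrightarrow> kernel_shift V KC b (fold (kernel_shift V KC) xs ?h) u = 0"
    by blast
  let ?g = "fold (kernel_shift V KC) xs ?h"
  have ev: "kernel_eigenvalue V KC b" using bs(1) b by auto
  then have "b \<in> set (ms @ xs)" using ms by auto
  from fold_kernel_shift_split[OF this, of V KC f] obtain z where z: "?g = kernel_shift V KC b z"
    by auto
  \<comment> \<open>\<open>?g\<close> is orthogonal to itself: the self-adjoint \<open>K - b\<close>
    moves to the other argument, which it annihilates.\<close>
  have "(\<Sum>u\<in>V. ?g u * cnj (?g u)) = (\<Sum>u\<in>V. kernel_shift V KC b z u * cnj (?g u))"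
    by (simp add: z)
  also have "\<dots> = (\<Sum>u\<in>V. z u * cnj (kernel_shift V KC b ?g u))"
    using kernel_eigenvalue_real[OF fin ev] by (simp add: kernel_shift_adjoint)
  also have "\<dots> = 0" using ker by simp
  finally show False using sum_mult_cnj_eq_0[OF fin _ w(1)] w(2) by blast
qed

text \<open>The product of \<open>K - a\<close>, \<open>K - b\<close>, \<open>K - c\<close> over the
  three eigenvalues is zero. Expanding it entry by entry gives the relation; \<open>s\<close>,
  \<open>t\<close>, \<open>w\<close> are, up to sign, the elementary symmetric functions of the
  eigenvalues.\<close>

lemma symmetric_kernel_cubic:
  assumes fin: "finite V" and card: "card (Collect (kernel_eigenvalue V KC)) = 3"
  shows "\<exists>s t w. \<forall>u\<in>V. \<forall>v\<in>V. (\<Sum>x\<in>V. \<Sum>y\<in>V. K u x * K x y * K y v)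
    = s * (\<Sum>x\<in>V. K u x * K x v) + t * K u v + (if u = v then w else 0)"
proof -
  obtain a b c where abc: "Collect (kernel_eigenvalue V KC) = {a, b, c}"
    using card unfolding card_3_iff by blast
  then have "cnj a = a" "cnj b = b" "cnj c = c"
    using kernel_eigenvalue_real[OF fin, of a] kernel_eigenvalue_real[OF fin, of b]
      kernel_eigenvalue_real[OF fin, of c] by auto
  then obtain a' b' c' where r: "a = of_real a'" "b = of_real b'" "c = of_real c'"
    unfolding Reals_cnj_iff[symmetric] by (auto elim!: Reals_cases)
  show ?thesis
  proof (intro exI ballI)
    fix u v
    assume uv: "u \<in> V" "v \<in> V"
    \<comment> \<open>Powers of \<open>K\<close> applied to the indicator of \<open>v\<close> give
      their column \<open>v\<close>, whose value at \<open>u\<close> is the desired entry.\<close>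
    define f where "f x = (if x = v then 1 else 0 :: complex)" for x
    have real_part: "S3 = p * S2 + - q * S1 + (if u = v then r else 0)"
      if "0 = complex_of_real (S3 - p * S2 + q * S1 - r * (if u = v then 1 else 0))" for S3 S2 S1 p q r
    proof -
      have "S3 - p * S2 + q * S1 - r * (if u = v then 1 else 0) = 0"
        using that by (metis of_real_eq_0_iff)
      then show ?thesis by (auto split: if_splits)
    qed
    have unit: "(\<Sum>y\<in>V. g y * f y) = g v" for g :: "'a \<Rightarrow> complex"
      using fin uv by (simp add: f_def if_distrib[of "(*) _"] sum.delta' cong: if_cong)
    have 1: "kernel_shift V KC a f = (\<lambda>x. KC x v - a * f x)"
      by (rule ext) (simp add: kernel_shift_def unit)
    have 2: "kernel_shift V KC b (kernel_shift V KC a f) =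
      (\<lambda>x. (\<Sum>y\<in>V. KC x y * KC y v) - (a + b) * KC x v + a * b * f x)"
    proof
      fix x
      have "(\<Sum>y\<in>V. KC x y * (KC y v - a * f y)) = (\<Sum>y\<in>V. KC x y * KC y v) - a * (\<Sum>y\<in>V. KC x y * f y)"
        by (simp add: right_diff_distrib sum_subtractf sum_distrib_left mult.left_commute)
      then show "kernel_shift V KC b (kernel_shift V KC a f) x
        = (\<Sum>y\<in>V. KC x y * KC y v) - (a + b) * KC x v + a * b * f x"
        by (simp add: 1 kernel_shift_def[of V KC b] unit) (simp add: algebra_simps)
    qed
    have "0 = kernel_shift V KC c (kernel_shift V KC b (kernel_shift V KC a f)) u"
      using symmetric_kernel_annihilated[OF fin, of "[a,b,c]" u f] abc uv by simp
    also have "\<dots> = (\<Sum>x\<in>V. \<Sum>y\<in>V. KC u x * KC x y * KC y v) - (a + b + c) * (\<Sum>x\<in>V. KC u x * KC x v)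
      + (a * b + b * c + a * c) * KC u v - a * b * c * f u"
    proof -
      have "(\<Sum>x\<in>V. KC u x * ((\<Sum>y\<in>V. KC x y * KC y v) - (a + b) * KC x v + a * b * f x))
        = (\<Sum>x\<in>V. KC u x * (\<Sum>y\<in>V. KC x y * KC y v)) - (a + b) * (\<Sum>x\<in>V. KC u x * KC x v)
          + a * b * (\<Sum>x\<in>V. KC u x * f x)"
        by (simp add: distrib_left right_diff_distrib sum.distrib sum_subtractf sum_distrib_left
            mult.left_commute)
      moreover have "(\<Sum>x\<in>V. KC u x * (\<Sum>y\<in>V. KC x y * KC y v)) = (\<Sum>x\<in>V. \<Sum>y\<in>V. KC u x * KC x y * KC y v)"
        by (simp add: sum_distrib_left mult.assoc)
      ultimately show ?thesis by (simp add: 2 kernel_shift_def[of V KC c] unit) (simp add: algebra_simps)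
    qed
    also have "\<dots> = of_real ((\<Sum>x\<in>V. \<Sum>y\<in>V. K u x * K x y * K y v) - (a' + b' + c') * (\<Sum>x\<in>V. K u x * K x v)
      + (a' * b' + b' * c' + a' * c') * K u v - a' * b' * c' * (if u = v then 1 else 0))"
      by (simp add: r f_def KC_def)
    finally show "(\<Sum>x\<in>V. \<Sum>y\<in>V. K u x * K x y * K y v)
      = (a' + b' + c') * (\<Sum>x\<in>V. K u x * K x v) + - (a' * b' + b' * c' + a' * c') * K u v
        + (if u = v then a' * b' * c' else 0)"
      by (rule real_part)
  qed
qed

end

section \<open>Tree metrics\<close>

text \<open>Acyclicity seen through distances alone: \<open>d_adj_neq\<close> rules out odd cycles
  and \<open>d_step_unique\<close> the remaining ones. The spectral arguments then need no
  walks.\<close>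

locale tree_metric =
  fixes V :: "'a set" and d :: "'a \<Rightarrow> 'a \<Rightarrow> nat"
  assumes finite_V: "finite V"
    and d_eq_0: "\<And>u v. u \<in> V \<Longrightarrow> v \<in> V \<Longrightarrow> d u v = 0 \<longleftrightarrow> u = v"
    and d_sym: "\<And>u v. u \<in> V \<Longrightarrow> v \<in> V \<Longrightarrow> d u v = d v u"
    and d_triangle: "\<And>u v w. u \<in> V \<Longrightarrow> v \<in> V \<Longrightarrow> w \<in> V \<Longrightarrow> d u w \<le> d u v + d v w"
    and d_step: "\<And>u v. u \<in> V \<Longrightarrow> v \<in> V \<Longrightarrow> u \<noteq> v \<Longrightarrow> \<exists>w\<in>V. d u w = 1 \<and> d u v = Suc (d w v)"
    and d_adj_neq: "\<And>u v w. u \<in> V \<Longrightarrow> v \<in> V \<Longrightarrow> w \<in> V \<Longrightarrow> d u w = 1 \<Longrightarrow> d u v \<noteq> d w v"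
    and d_step_unique: "\<And>u v w w'. u \<in> V \<Longrightarrow> v \<in> V \<Longrightarrow> w \<in> V \<Longrightarrow> w' \<in> V \<Longrightarrow>
      d u w = 1 \<Longrightarrow> d u w' = 1 \<Longrightarrow> d u v = Suc (d w v) \<Longrightarrow> d u v = Suc (d w' v) \<Longrightarrow> w = w'"
begin

section \<open>Geometry of tree metrics\<close>

lemma d_refl: "u \<in> V \<Longrightarrow> d u u = 0"
  by (simp add: d_eq_0)

lemma d_adj_cases:
  assumes "u \<in> V" "v \<in> V" "w \<in> V" "d u w = 1"
  obtains "d u v = Suc (d w v)" | "d w v = Suc (d u v)"
  using d_adj_neq[OF assms] d_triangle[of u w v] d_triangle[of w u v] d_sym[of u w] assms by linarith

lemma d_between:
  assumes "u \<in> V" "v \<in> V" "m \<le> d u v"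
  shows "\<exists>w\<in>V. d u w = m \<and> d w v = d u v - m"
  using assms(3)
proof (induction m)
  case 0
  then show ?case using assms d_refl by auto
next
  case (Suc m)
  then obtain w where w: "w \<in> V" "d u w = m" "d w v = d u v - m" by auto
  have "w \<noteq> v" using Suc.prems w d_refl assms by auto
  then obtain x where x: "x \<in> V" "d w x = 1" "d w v = Suc (d x v)" using d_step w assms by blast
  have "d u v \<le> d u x + d x v" "d u x \<le> d u w + d w x"
    using d_triangle[of u x v] d_triangle[of u w x] assms w x by auto
  then have "d u x = Suc m \<and> d x v = d u v - Suc m" using w x by linarith
  then show ?case using x by blast
qed

text \<open>The two sides of an edge \<open>x y\<close> are distinguished by which endpoint is closer.\<close>

lemma d_across_edge:
  assumes "x \<in> V" "y \<in> V" "u \<in> V" "v \<in> V" "d x y = 1" "d x u < d y u" "d y v < d x v"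
  shows "d u v = d u x + 1 + d y v"
  using assms(4,7)
\<comment> \<open>Induction on the depth of \<open>v\<close> behind \<open>y\<close>;
  \<open>v'\<close> is the neighbour of \<open>v\<close> towards \<open>y\<close> and is again on
  the side of \<open>y\<close>.\<close>
proof (induction "d y v" arbitrary: v rule: less_induct)
  case less
  have du: "d y u = Suc (d x u)" using d_adj_cases[of x u y] assms by auto
  have dv: "d x v = Suc (d y v)" using d_adj_cases[of x v y] assms less by auto
  show ?case
  proof (cases "v = y")
    case True
    then show ?thesis using du d_sym assms d_refl by simp
  next
    case False
    then obtain v' where v': "v' \<in> V" "d v v' = 1" "d v y = Suc (d v' y)"
      using d_step less assms by blast
    have eq: "d y v = Suc (d y v')" "d v' v = 1" using v' d_sym less.prems assms by auto
    have "d x v \<le> d x v' + d v' v" using d_triangle assms v' less.prems by blast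
    then have dv': "d x v' = Suc (d y v')" using d_adj_cases[of x v' y] v' assms dv eq by force
    then have IH: "d u v' = d u x + 1 + d y v'" using less.hyps[of v'] v' eq by simp
    \<comment> \<open>\<open>w\<close> is the neighbour of \<open>v'\<close> towards
      \<open>u\<close>: it is \<open>x\<close> if \<open>v' = y\<close>, and otherwise the next
      vertex towards \<open>y\<close>. Since only one neighbour of \<open>v'\<close> is nearer to
      \<open>u\<close>, the vertex \<open>v\<close> must be farther from \<open>u\<close> than
      \<open>v'\<close>.\<close>
    obtain w where w: "w \<in> V" "d v' w = 1" "d v' u = Suc (d w u)" "w \<noteq> v"
    proof (cases "v' = y")
      case True
      have "x \<noteq> v" using less.prems d_refl assms by auto
      then show ?thesis using that[of x] True du assms d_sym by auto
    next
      case False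
      then obtain z where z: "z \<in> V" "d v' z = 1" "d v' y = Suc (d z y)"
        using d_step v' assms by blast
      then have yz: "d y v' = Suc (d y z)" "d z v' = 1" using d_sym v' assms by auto
      have "d x v' \<le> d x z + d z v'" using d_triangle assms v' z by blast
      then have "d y z < d x z" using yz dv' by simp
      then have "d u z = d u x + 1 + d y z" using less.hyps[of z] z yz eq by simp
      then have "d v' u = Suc (d z u)" using IH yz d_sym z v' assms by simp
      moreover have "z \<noteq> v" using yz eq by auto
      ultimately show ?thesis using that z by blast
    qed
    have "d v' u \<noteq> Suc (d v u)"
      using d_step_unique[of v' u v w] w v' eq less.prems assms by blast
    then have "d v u = Suc (d v' u)"
      using d_adj_cases[of v' u v] v' eq less.prems assms by blast
    then show ?thesis using IH eq d_sym less.prems assms v' by simp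
  qed
qed

section \<open>The eccentricity kernel\<close>

definition ecc :: "'a \<Rightarrow> nat" where
  "ecc u = Max (d u ` V)"

definition ecc_kernel :: "'a \<Rightarrow> 'a \<Rightarrow> real" where
  "ecc_kernel u v = (if d u v = min (ecc u) (ecc v) then real (d u v) else 0)"

lemma ecc_eqI: "v \<in> V \<Longrightarrow> d u v = m \<Longrightarrow> (\<And>v. v \<in> V \<Longrightarrow> d u v \<le> m) \<Longrightarrow> ecc u = m"
  unfolding ecc_def using finite_V by (intro Max_eqI) auto

lemma ecc_kernel_sym: "u \<in> V \<Longrightarrow> v \<in> V \<Longrightarrow> ecc_kernel u v = ecc_kernel v u"
  by (simp add: ecc_kernel_def d_sym min.commute)

lemma ecc_kernel_nonneg: "ecc_kernel u v \<ge> 0"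
  by (simp add: ecc_kernel_def)

abbreviation three_ecc_eigenvalues :: bool where
  "three_ecc_eigenvalues \<equiv>
    card (Collect (kernel_eigenvalue V (\<lambda>u v. complex_of_real (ecc_kernel u v)))) = 3"

section \<open>Trees of odd diameter\<close>

lemma odd_diameter_not_three_eigenvalues:
  assumes ab: "a \<in> V" "b \<in> V" "d a b = 2 * k + 1" and "k \<ge> 1"
    and diam: "\<And>u v. u \<in> V \<Longrightarrow> v \<in> V \<Longrightarrow> d u v \<le> 2 * k + 1"
  shows "\<not> three_ecc_eigenvalues"
proof
  assume three: three_ecc_eigenvalues
  obtain x where x: "x \<in> V" "d a x = k" "d x b = k + 1"
    using d_between[of a b k] ab by auto
  then have "x \<noteq> b" using ab d_refl by auto
  then obtain y where y: "y \<in> V" "d x y = 1" "d x b = Suc (d y b)" using d_step x ab by blast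
  have "d a b \<le> d a y + d y b" using d_triangle ab y by blast
  then have "k < d a y" using ab x y by simp
  then have a_side: "d x a < d y a" using x y ab d_sym by simp
  have b_side: "d y b < d x b" using y by simp
  \<comment> \<open>A deeper vertex would be at distance more than \<open>2 * k + 1\<close> from
    \<open>b\<close>, which lies at depth \<open>k\<close> behind \<open>y\<close>.\<close>
  have depth_x: "d u x \<le> k" if "u \<in> V" "d x u < d y u" for u
    using d_across_edge[of x y u b] that ab x y diam[of u b] by simp
  have depth_y: "d y v \<le> k" if "v \<in> V" "d y v < d x v" for v
    using d_across_edge[of x y a v] that ab x y a_side diam[of a v] by simp
  have side: "d x u < d y u \<or> d y u < d x u" if "u \<in> V" for u
    using d_adj_neq[of x u y] that x y by force
  \<comment> \<open>The far end \<open>b\<close> attains the maximum: vertices across the edge have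
    depth at most \<open>k\<close>, and those on the same side are reached through \<open>x\<close>
    within \<open>d u x + k\<close>.\<close>
  have ecc_x: "ecc u = d u x + k + 1" if u: "u \<in> V" "d x u < d y u" for u
  proof (rule ecc_eqI[of b])
    show "d u b = d u x + k + 1" using d_across_edge[of x y u b] u ab x y by simp
    fix v assume v: "v \<in> V"
    show "d u v \<le> d u x + k + 1"
    proof (cases "d x v < d y v")
      case True
      then show ?thesis using d_triangle[of u x v] depth_x[of v] d_sym[of x v] u v x by simp
    next
      case False
      then have "d y v < d x v" using side v by blast
      then show ?thesis using d_across_edge[of x y u v] depth_y[of v] u v x y by simp
    qed
  qed (use ab in auto)
  have ecc_y: "ecc v = d y v + k + 1" if v: "v \<in> V" "d y v < d x v" for v
  proof (rule ecc_eqI[of a])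
    show "d v a = d y v + k + 1"
      using d_across_edge[of x y a v] v ab x y a_side d_sym[of v a] by simp
    fix u assume u: "u \<in> V"
    show "d v u \<le> d y v + k + 1"
    proof (cases "d x u < d y u")
      case True
      then show ?thesis
        using d_across_edge[of x y u v] depth_x[of u] u v x y d_sym[of v u] by simp
    next
      case False
      then have "d y u < d x u" using side u by blast
      then show ?thesis using d_triangle[of v y u] depth_y[of u] d_sym[of v y] u v y by simp
    qed
  qed (use ab in auto)
  \<comment> \<open>On one side the distance is at most the sum of the two depths, each at most
    \<open>k\<close>, so it stays below both eccentricities.\<close>
  have zero_x: "ecc_kernel u v = 0" if "u \<in> V" "v \<in> V" "d x u < d y u" "d x v < d y v" for u v
    using that d_triangle[of u x v] d_sym[of x v] depth_x[of u] depth_x[of v] ecc_x[of u] ecc_x[of v] x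
    by (simp add: ecc_kernel_def)
  have zero_y: "ecc_kernel u v = 0" if "u \<in> V" "v \<in> V" "d y u < d x u" "d y v < d x v" for u v
    using that d_triangle[of u y v] d_sym[of y u] depth_y[of u] depth_y[of v] ecc_y[of u] ecc_y[of v] y
    by (simp add: ecc_kernel_def)
  have x_side: "d x x < d y x" and y_side: "d y y < d x y" using x y d_refl d_sym[of x y] by simp_all
  \<comment> \<open>The distance is 1 but both eccentricities are \<open>k + 1\<close>; this is
    where \<open>k \<ge> 1\<close> enters.\<close>
  have Kxy: "ecc_kernel x y = 0"
    using ecc_x[OF _ x_side] ecc_y[OF _ y_side] x y d_refl \<open>k \<ge> 1\<close> by (simp add: ecc_kernel_def)
  have Kxb: "ecc_kernel x b > 0"
    using ecc_x[OF _ x_side] ecc_y[OF _ b_side] x y ab d_refl by (simp add: ecc_kernel_def)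
  have Kba: "ecc_kernel b a > 0"
    using ecc_x[OF _ a_side] ecc_y[OF _ b_side] x y ab d_sym[of a b] by (simp add: ecc_kernel_def)
  have "d a y = k + 1"
    using d_across_edge[of x y a y] x y ab a_side y_side d_refl by simp
  then have Kay: "ecc_kernel a y > 0"
    using ecc_x[OF _ a_side] ecc_y[OF _ y_side] x y ab d_refl by (simp add: ecc_kernel_def)
  obtain s t w where cubic: "\<And>u v. u \<in> V \<Longrightarrow> v \<in> V \<Longrightarrow>
    (\<Sum>p\<in>V. \<Sum>q\<in>V. ecc_kernel u p * ecc_kernel p q * ecc_kernel q v)
    = s * (\<Sum>p\<in>V. ecc_kernel u p * ecc_kernel p v) + t * ecc_kernel u v + (if u = v then w else 0)"
    using symmetric_kernel_cubic[OF ecc_kernel_sym finite_V three] by blast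
  \<comment> \<open>Whichever side \<open>p\<close> is on, it shares it with \<open>x\<close> or
    with \<open>y\<close>, and the corresponding factor vanishes.\<close>
  have "(\<Sum>p\<in>V. ecc_kernel x p * ecc_kernel p y) = 0"
  proof (rule sum.neutral, rule ballI)
    fix p assume "p \<in> V"
    then show "ecc_kernel x p * ecc_kernel p y = 0"
      using side[of p] zero_x[of x p] zero_y[of p y] x_side y_side x y by auto
  qed
  moreover have "x \<noteq> y" using x_side by auto
  ultimately have "(\<Sum>p\<in>V. \<Sum>q\<in>V. ecc_kernel x p * ecc_kernel p q * ecc_kernel q y) = 0"
    using cubic[of x y] x y Kxy by simp
  moreover have "0 < ecc_kernel x b * ecc_kernel b a * ecc_kernel a y"
    using Kxb Kba Kay by simp
  moreover have "\<dots> \<le> (\<Sum>q\<in>V. ecc_kernel x b * ecc_kernel b q * ecc_kernel q y)"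
    using finite_V ab by (intro member_le_sum) (auto simp: ecc_kernel_nonneg)
  moreover have "\<dots> \<le> (\<Sum>p\<in>V. \<Sum>q\<in>V. ecc_kernel x p * ecc_kernel p q * ecc_kernel q y)"
    using finite_V ab by (intro member_le_sum) (auto simp: ecc_kernel_nonneg intro!: sum_nonneg)
  ultimately show False by linarith
qed

section \<open>Trees of even diameter\<close>

lemma
  assumes "a \<in> V" "b \<in> V" "c \<in> V" "d c a = k" "d c b = k" "d a b = 2 * k"
    and diam: "\<And>u v. u \<in> V \<Longrightarrow> v \<in> V \<Longrightarrow> d u v \<le> 2 * k"
    and "u \<in> V"
  shows even_radius_depth: "d c u \<le> k" and even_radius_ecc: "ecc u = d c u + k"
proof -
  \<comment> \<open>A vertex \<open>u\<close> lies in at most one branch at \<open>c\<close>, and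
    \<open>a\<close> and \<open>b\<close> lie in different branches. So one of them is reached from
    \<open>u\<close> only through \<open>c\<close>; the diameter bound then limits the depth of
    \<open>u\<close>.\<close>
  have far: "\<exists>v\<in>V. d c v = k \<and> d u v = d c u + k" if u: "u \<in> V" for u
  proof (cases "k = 0")
    case True
    then show ?thesis using assms d_refl d_eq_0 d_sym u by (metis add_0_right)
  next
    case False
    then have "c \<noteq> a" using assms d_refl by auto
    then obtain x where x: "x \<in> V" "d c x = 1" "d c a = Suc (d x a)" using d_step assms by blast
    show ?thesis
    proof (cases "d x u < d c u")
      case False
      then have "d c u < d x u" using d_adj_neq[of c u x] u assms x by force
      then have "d a u = d a x + 1 + d c u"
        using d_across_edge[of x c a u] x u assms d_sym[of c x] by simp
      then show ?thesis using x assms u d_sym[of a u] d_sym[of a x] by force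
    next
      case True
      have "d a b \<le> d a x + d x b" using d_triangle assms x by blast
      then have "d c b < d x b" using assms x d_sym[of a x] by simp
      then have "d u b = d u x + 1 + d c b"
        using d_across_edge[of x c u b] x u True assms d_sym[of c x] by simp
      moreover have "d c u = Suc (d x u)" using d_adj_cases[of c u x] True u x assms by auto
      ultimately show ?thesis using assms u x d_sym[of u x] by force
    qed
  qed
  have depth: "d c u \<le> k" if "u \<in> V" for u
    using far[OF that] diam[of u] that by fastforce
  show "d c u \<le> k" using depth \<open>u \<in> V\<close> .
  obtain v where "v \<in> V" "d u v = d c u + k" using far[OF \<open>u \<in> V\<close>] by blast
  then show "ecc u = d c u + k"
  proof (rule ecc_eqI)
    fix v assume "v \<in> V"
    then show "d u v \<le> d c u + k"
      using d_triangle[of u c v] depth[of v] d_sym[of u c] assms by simp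
  qed
qed

lemma even_diameter_not_three_eigenvalues:
  assumes ab: "a \<in> V" "b \<in> V" "d a b = 2 * k" and "k \<ge> 2"
    and diam: "\<And>u v. u \<in> V \<Longrightarrow> v \<in> V \<Longrightarrow> d u v \<le> 2 * k"
  shows "\<not> three_ecc_eigenvalues"
proof
  assume three: three_ecc_eigenvalues
  obtain c where c: "c \<in> V" "d c a = k" "d c b = k"
    using d_between[of a b k] ab d_sym by auto
  note depth = even_radius_depth[OF ab(1,2) c ab(3) diam]
  note ecc = even_radius_ecc[OF ab(1,2) c ab(3) diam]
  have branch: "\<exists>x\<in>V. d c x = 1 \<and> d x u < d c u" if "u \<in> V" "u \<noteq> c" for u
    using d_step[of c u] that c by force
  have branch_unique: "x = y" if "u \<in> V" "x \<in> V" "y \<in> V" "d c x = 1" "d c y = 1"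
    "d x u < d c u" "d y u < d c u" for u x y
  proof (rule d_step_unique[of c u])
    show "d c u = Suc (d x u)" using d_adj_cases[of c u x] that c by auto
    show "d c u = Suc (d y u)" using d_adj_cases[of c u y] that c by auto
  qed (use that c in auto)
  have Kc: "ecc_kernel c v = (if d c v = k then k else 0)" if "v \<in> V" for v
    using that ecc[of c] ecc[of v] c d_refl by (simp add: ecc_kernel_def)
  \<comment> \<open>Here \<open>ecc x = k + 1\<close>. Inside its own branch \<open>x\<close> has
    distances at most \<open>k - 1\<close>, too small; outside, only depth \<open>k\<close> reaches
    \<open>k + 1\<close>. The entry at \<open>c\<close> is zero because \<open>d x c = 1\<close>
    while \<open>ecc c = k \<ge> 2\<close>.\<close>
  have Kx: "ecc_kernel x v = (if d c v = k \<and> d c v < d x v then k + 1 else 0)"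
    if vx: "v \<in> V" "x \<in> V" "d c x = 1" for v x
  proof -
    consider (closer) "d c v = Suc (d x v)" | (farther) "d x v = Suc (d c v)"
      using d_adj_cases[of c v x] vx c by blast
    then show ?thesis
    proof cases
      case closer
      then show ?thesis using vx ecc[of x] ecc[of v] depth[of v] by (auto simp: ecc_kernel_def min_def)
    next
      case farther
      then show ?thesis
        using vx ecc[of x] ecc[of v] depth[of v] \<open>k \<ge> 2\<close> by (auto simp: ecc_kernel_def min_def)
    qed
  qed
  define X where "X = {x \<in> V. d c x = 1 \<and> (\<exists>v\<in>V. d c v = k \<and> d x v < d c v)}"
  have X: "x \<in> V" "d c x = 1" if "x \<in> X" for x using that by (auto simp: X_def)
  have "finite X" using finite_V by (simp add: X_def)
  have "c \<notin> X" using X(2) c d_refl by force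
  \<comment> \<open>\<open>X\<close> has one vertex in each branch meeting the periphery; \<open>c\<close> is weighted to cancel the sum.\<close>
  define z where "z v = (if v = c then (1 - real (card X)) * (k + 1) / k else if v \<in> X then 1 else 0)" for v
  have Kz: "(\<Sum>v\<in>V. ecc_kernel u v * z v) = 0" if u: "u \<in> V" for u
  proof -
    have "(\<Sum>v\<in>V. ecc_kernel u v * z v) = (\<Sum>v\<in>insert c X. ecc_kernel u v * z v)"
      using finite_V X c by (intro sum.mono_neutral_right) (auto simp: z_def)
    also have "\<dots> = ecc_kernel c u * z c + (\<Sum>x\<in>X. ecc_kernel x u)"
      using \<open>finite X\<close> \<open>c \<notin> X\<close> ecc_kernel_sym[OF u] X c by (auto simp: z_def intro!: sum.cong)
    also have "\<dots> = 0"
    proof (cases "d c u = k")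
      case False
      then show ?thesis using Kc Kx u X by simp
    next
      case True
      then have "u \<noteq> c" using \<open>k \<ge> 2\<close> d_refl u by auto
      then obtain x where x: "x \<in> V" "d c x = 1" "d x u < d c u" using branch u by blast
      then have "x \<in> X" using True u by (auto simp: X_def)
      \<comment> \<open>A peripheral \<open>u\<close> lies in the branch of exactly one member of
        \<open>X\<close>, so all the others contribute \<open>k + 1\<close> each. The weight of
        \<open>c\<close> cancels this total.\<close>
      have "(\<Sum>y\<in>X. ecc_kernel y u) = (\<Sum>y\<in>X - {x}. real (k + 1))"
      proof (rule sum.mono_neutral_cong_right)
        show "\<forall>i\<in>X - (X - {x}). ecc_kernel i u = 0" using Kx[OF u] x by auto
        fix y assume y: "y \<in> X - {x}"
        then have "\<not> d y u < d c u" using branch_unique[OF u, of x y] x X by auto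
        then have "d c u < d y u" using d_adj_neq[of c u y] y X u c by force
        then show "ecc_kernel y u = real (k + 1)" using Kx[OF u, of y] y X True by auto
      qed (use \<open>finite X\<close> in auto)
      also have "\<dots> = (real (card X) - 1) * (k + 1)"
        using \<open>finite X\<close> \<open>x \<in> X\<close> card_gt_0_iff[of X] by (auto simp: of_nat_diff Suc_leI)
      finally show ?thesis using Kc[OF u] True \<open>k \<ge> 2\<close> by (simp add: z_def) (simp add: algebra_simps)
    qed
    finally show ?thesis .
  qed
  obtain s t w where cubic: "\<And>u v. u \<in> V \<Longrightarrow> v \<in> V \<Longrightarrow>
    (\<Sum>p\<in>V. \<Sum>q\<in>V. ecc_kernel u p * ecc_kernel p q * ecc_kernel q v)
    = s * (\<Sum>p\<in>V. ecc_kernel u p * ecc_kernel p v) + t * ecc_kernel u v + (if u = v then w else 0)"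
    using symmetric_kernel_cubic[OF ecc_kernel_sym finite_V three] by blast
  have "a \<noteq> c" using c \<open>k \<ge> 2\<close> d_refl by auto
  then obtain x where x: "x \<in> V" "d c x = 1" "d x a < d c a" using branch ab by blast
  then have "x \<in> X" using ab c by (auto simp: X_def)
  have "x \<noteq> c" using x c d_refl by auto
  \<comment> \<open>Pair row \<open>x\<close> of the cubic relation with \<open>z\<close>. Every
    term ending in a factor \<open>K\<close> vanishes, leaving \<open>w * z x\<close> with
    \<open>z x = 1\<close>.\<close>
  have "w = 0"
  proof -
    have "(\<Sum>v\<in>V. (\<Sum>p\<in>V. \<Sum>q\<in>V. ecc_kernel x p * ecc_kernel p q * ecc_kernel q v) * z v)
      = (\<Sum>p\<in>V. \<Sum>q\<in>V. ecc_kernel x p * ecc_kernel p q * (\<Sum>v\<in>V. ecc_kernel q v * z v))"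
      unfolding sum_distrib_left sum_distrib_right
      by (subst sum.swap, rule sum.cong[OF refl], subst sum.swap) (simp add: mult.assoc)
    also have "\<dots> = 0" using Kz by simp
    finally have "(\<Sum>v\<in>V. (\<Sum>p\<in>V. \<Sum>q\<in>V. ecc_kernel x p * ecc_kernel p q * ecc_kernel q v) * z v) = 0" .
    moreover have "(\<Sum>v\<in>V. (\<Sum>p\<in>V. ecc_kernel x p * ecc_kernel p v) * z v)
      = (\<Sum>p\<in>V. ecc_kernel x p * (\<Sum>v\<in>V. ecc_kernel p v * z v))"
      unfolding sum_distrib_left sum_distrib_right
      by (subst sum.swap) (simp add: mult.assoc)
    then have "(\<Sum>v\<in>V. (\<Sum>p\<in>V. ecc_kernel x p * ecc_kernel p v) * z v) = 0" using Kz by simp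
    moreover have "(\<Sum>v\<in>V. (if x = v then w else 0) * z v) = w * z x"
      using finite_V x by (simp add: if_distrib[of "\<lambda>y. y * _"] sum.delta cong: if_cong)
    moreover have "(\<Sum>v\<in>V. (\<Sum>p\<in>V. \<Sum>q\<in>V. ecc_kernel x p * ecc_kernel p q * ecc_kernel q v) * z v)
      = (\<Sum>v\<in>V. s * ((\<Sum>p\<in>V. ecc_kernel x p * ecc_kernel p v) * z v)
          + t * (ecc_kernel x v * z v) + (if x = v then w else 0) * z v)"
      using cubic x by (intro sum.cong) (simp_all add: distrib_right mult.assoc)
    then have "(\<Sum>v\<in>V. (\<Sum>p\<in>V. \<Sum>q\<in>V. ecc_kernel x p * ecc_kernel p q * ecc_kernel q v) * z v)
      = s * (\<Sum>v\<in>V. (\<Sum>p\<in>V. ecc_kernel x p * ecc_kernel p v) * z v)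
        + t * (\<Sum>v\<in>V. ecc_kernel x v * z v) + (\<Sum>v\<in>V. (if x = v then w else 0) * z v)"
      by (simp only: sum.distrib sum_distrib_left)
    ultimately have "0 = w * z x" using Kz[of x] x by simp
    then show ?thesis using \<open>x \<in> X\<close> \<open>x \<noteq> c\<close> by (simp add: z_def)
  qed
  \<comment> \<open>\<open>\<alpha>\<close> and \<open>\<beta>\<close> are the indicators of the
    sets called P and Q in the introduction; as Q is contained in P, their product is
    \<open>\<beta>\<close>.\<close>
  define \<alpha> \<beta> where "\<alpha> v = (if d c v = k then 1 else 0 :: real)"
    and "\<beta> v = (if d c v = k \<and> d c v < d x v then 1 else 0 :: real)" for v
  have \<alpha>: "ecc_kernel c v = k * \<alpha> v" and \<beta>: "ecc_kernel x v = (k + 1) * \<beta> v" if "v \<in> V" for v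
    using Kc[OF that] Kx[OF that x(1,2)] by (simp_all add: \<alpha>_def \<beta>_def)
  have \<beta>': "ecc_kernel v x = (k + 1) * \<beta> v" if "v \<in> V" for v
    using \<beta>[OF that] ecc_kernel_sym that x by simp
  have mult: "\<alpha> v * \<beta> v = \<beta> v" "\<beta> v * \<beta> v = \<beta> v" for v by (simp_all add: \<alpha>_def \<beta>_def)
  \<comment> \<open>The relation at \<open>(c, x)\<close>, where the linear term drops out because
    \<open>d c x = 1\<close> and \<open>k \<ge> 2\<close>.\<close>
  have "k * (k + 1) * (\<Sum>p\<in>V. \<Sum>q\<in>V. \<alpha> p * ecc_kernel p q * \<beta> q) = k * (k + 1) * (s * (\<Sum>p\<in>V. \<beta> p))"
  proof -
    have "ecc_kernel c x = 0" using Kc[of x] x \<open>k \<ge> 2\<close> by simp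
    moreover have "(\<Sum>p\<in>V. \<Sum>q\<in>V. ecc_kernel c p * ecc_kernel p q * ecc_kernel q x)
      = k * (k + 1) * (\<Sum>p\<in>V. \<Sum>q\<in>V. \<alpha> p * ecc_kernel p q * \<beta> q)"
      unfolding sum_distrib_left by (intro sum.cong) (simp_all add: \<alpha> \<beta>' algebra_simps)
    moreover have "(\<Sum>p\<in>V. ecc_kernel c p * ecc_kernel p x) = k * (k + 1) * (\<Sum>p\<in>V. \<alpha> p * \<beta> p)"
      unfolding sum_distrib_left by (intro sum.cong) (simp_all add: \<alpha> \<beta>' algebra_simps)
    ultimately show ?thesis using cubic[of c x] c x \<open>x \<noteq> c\<close> by (auto simp: mult)
  qed
  then have 1: "(\<Sum>p\<in>V. \<Sum>q\<in>V. \<alpha> p * ecc_kernel p q * \<beta> q) = s * (\<Sum>p\<in>V. \<beta> p)"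
    using \<open>k \<ge> 2\<close> by (auto simp: add_nonneg_eq_0_iff)
  \<comment> \<open>The relation at \<open>(x, x)\<close>. This entry is diagonal, which is why
    \<open>w = 0\<close> had to be shown first.\<close>
  have "(k + 1) * (k + 1) * (\<Sum>p\<in>V. \<Sum>q\<in>V. \<beta> p * ecc_kernel p q * \<beta> q) = (k + 1) * (k + 1) * (s * (\<Sum>p\<in>V. \<beta> p))"
  proof -
    have "ecc_kernel x x = 0" using Kx[of x x] x \<open>k \<ge> 2\<close> by simp
    moreover have "(\<Sum>p\<in>V. \<Sum>q\<in>V. ecc_kernel x p * ecc_kernel p q * ecc_kernel q x)
      = (k + 1) * (k + 1) * (\<Sum>p\<in>V. \<Sum>q\<in>V. \<beta> p * ecc_kernel p q * \<beta> q)"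
      unfolding sum_distrib_left by (intro sum.cong) (simp_all add: \<beta> \<beta>' algebra_simps)
    moreover have "(\<Sum>p\<in>V. ecc_kernel x p * ecc_kernel p x) = (k + 1) * (k + 1) * (\<Sum>p\<in>V. \<beta> p * \<beta> p)"
      unfolding sum_distrib_left by (intro sum.cong) (simp_all add: \<beta> \<beta>' algebra_simps)
    ultimately show ?thesis using cubic[of x x] x \<open>w = 0\<close> by (auto simp: mult)
  qed
  then have 2: "(\<Sum>p\<in>V. \<Sum>q\<in>V. \<beta> p * ecc_kernel p q * \<beta> q) = s * (\<Sum>p\<in>V. \<beta> p)"
    by (auto simp: add_nonneg_eq_0_iff)
  have "(\<Sum>p\<in>V. \<Sum>q\<in>V. (\<alpha> p - \<beta> p) * ecc_kernel p q * \<beta> q) = 0"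
    using 1 2 by (simp add: left_diff_distrib sum_subtractf)
  moreover have nonneg: "0 \<le> (\<alpha> p - \<beta> p) * ecc_kernel p q * \<beta> q" for p q
    by (auto simp: \<alpha>_def \<beta>_def ecc_kernel_nonneg)
  have "(\<alpha> a - \<beta> a) * ecc_kernel a b * \<beta> b \<le> (\<Sum>q\<in>V. (\<alpha> a - \<beta> a) * ecc_kernel a q * \<beta> q)"
    using finite_V ab nonneg by (intro member_le_sum) auto
  moreover have "\<dots> \<le> (\<Sum>p\<in>V. \<Sum>q\<in>V. (\<alpha> p - \<beta> p) * ecc_kernel p q * \<beta> q)"
    using finite_V ab nonneg by (intro member_le_sum[of a]) (auto intro!: sum_nonneg)
  \<comment> \<open>\<open>a\<close> lies in the branch of \<open>x\<close>, so it is in P but not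
    in Q. As \<open>d a b = 2 * k\<close> and \<open>d a x < k\<close>, the vertex \<open>b\<close>
    is outside that branch and hence in Q.\<close>
  moreover have "0 < (\<alpha> a - \<beta> a) * ecc_kernel a b * \<beta> b"
  proof -
    have "d c a = Suc (d x a)" using d_adj_cases[of c a x] x c ab by auto
    then have "d x a < k" "d a x = d x a" using c d_sym x ab by auto
    moreover have "d a b \<le> d a x + d x b" using d_triangle ab x by blast
    ultimately have "d c b < d x b" using ab c \<open>d c a = Suc (d x a)\<close> by simp
    moreover have "ecc_kernel a b > 0" using ecc ab c \<open>k \<ge> 2\<close> by (simp add: ecc_kernel_def)
    ultimately show ?thesis using c x by (simp add: \<alpha>_def \<beta>_def)
  qed
  ultimately show False by linarith
qed

lemma three_eigenvalues_imp_star: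
  assumes "card V \<ge> 3" three_ecc_eigenvalues
  shows "\<exists>c\<in>V. \<forall>u\<in>V - {c}. d c u = 1"
proof -
  define D where "D = Max ((\<lambda>(u, v). d u v) ` (V \<times> V))"
  have "V \<noteq> {}" using assms by auto
  then have "D \<in> (\<lambda>(u, v). d u v) ` (V \<times> V)" unfolding D_def using finite_V by (intro Max_in) auto
  then obtain a b where ab: "a \<in> V" "b \<in> V" "d a b = D" by auto
  have diam: "d u v \<le> D" if "u \<in> V" "v \<in> V" for u v
    unfolding D_def using that finite_V by (intro Max_ge) auto
  \<comment> \<open>A third vertex excludes diameters 0 and 1; in the latter case it would form a
    triangle with \<open>a\<close> and \<open>b\<close>. Only diameter 2 survives, and its centre is
    adjacent to every other vertex.\<close>
  have "\<not> V \<subseteq> {a, b}"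
    using assms(1) card_mono[of "{a, b}" V] card_insert_le_m1[of 2 "{b}" a] by auto
  then obtain e where e: "e \<in> V" "e \<noteq> a" "e \<noteq> b" by blast
  show ?thesis
  proof (cases "odd D")
    case True
    then obtain k where k: "D = 2 * k + 1" by (auto elim: oddE)
    have "k < 1" using odd_diameter_not_three_eigenvalues[of a b k] ab diam assms(2) k by fastforce
    then have "D = 1" using k by simp
    have "d a e = 1" "d b e = 1"
      using diam[of a e] diam[of b e] d_eq_0[of a e] d_eq_0[of b e] e ab \<open>D = 1\<close> by force+
    then show ?thesis using d_adj_neq[of a e b] ab e \<open>D = 1\<close> by simp
  next
    case False
    then obtain k where k: "D = 2 * k" by (auto elim: evenE)
    have "k < 2" using even_diameter_not_three_eigenvalues[of a b k] ab diam assms(2) k by fastforce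
    moreover have "k \<noteq> 0" using diam[of a e] d_eq_0[of a e] e ab k by auto
    ultimately have "k = 1" by simp
    obtain c where c: "c \<in> V" "d a c = 1" "d c b = 1" using d_between[of a b 1] ab k \<open>k = 1\<close> by auto
    have "d c u = 1" if "u \<in> V - {c}" for u
      using even_radius_depth[of a b c 1 u] ab c diam k \<open>k = 1\<close> that d_eq_0[of c u] d_sym[of a c] by force
    then show ?thesis using c by blast
  qed
qed

end

section \<open>Stars and undirected trees\<close>

context tree_metric
begin

text \<open>Entries are 1 between centre and leaf and 2 between distinct leaves. Vectors on the
  leaves with sum zero give -2; any other eigenvector is constant on the leaves, and eliminating its
  value at the centre gives the quadratic.\<close>

lemma star_eigenvalue_iff:
  fixes b :: complex
  assumes c: "c \<in> V" and star: "\<And>u. u \<in> V - {c} \<Longrightarrow> d c u = 1" and card: "card V = m + 1" and "m \<ge> 2"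
  shows "kernel_eigenvalue V (\<lambda>u v. complex_of_real (ecc_kernel u v)) b
    \<longleftrightarrow> b = -2 \<or> b * (b - 2 * (of_nat m - 1)) = of_nat m"
proof -
  define L where "L = V - {c}"
  have L: "finite L" "c \<notin> L" "V = insert c L" "card L = m"
    using finite_V c card by (auto simp: L_def)
  have L_V: "u \<in> V" if "u \<in> L" for u using that by (simp add: L_def)
  have sum_V: "(\<Sum>v\<in>V. g v) = g c + (\<Sum>v\<in>L. g v)" for g :: "'a \<Rightarrow> complex"
    using L by simp
  have star_c: "d c u = 1" "d u c = 1" if "u \<in> L" for u
    using star[of u] d_sym[of u c] that c by (auto simp: L_def)
  have leaves: "d u v = 2" if "u \<in> L" "v \<in> L" "u \<noteq> v" for u v
  proof -
    have uv: "u \<in> V" "v \<in> V" using that by (auto simp: L_def)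
    have "d u v \<le> 2" using d_triangle[of u c v] star_c that uv c by simp
    moreover have "d u v \<noteq> 0" using d_eq_0 uv that by simp
    moreover have "d u v \<noteq> 1" using d_adj_neq[of u c v] star_c that uv c by auto
    ultimately show ?thesis by linarith
  qed
  obtain x y where xy: "x \<in> L" "y \<in> L" "x \<noteq> y"
  proof -
    have "\<not> card L \<le> Suc 0" using L(4) \<open>m \<ge> 2\<close> by simp
    then show ?thesis using that card_le_Suc0_iff_eq[OF L(1)] by blast
  qed
  have ecc_c: "ecc c = 1"
    using ecc_eqI[of x c 1] xy star_c L(3) d_refl c by fastforce
  have ecc_leaf: "ecc u = 2" if u: "u \<in> L" for u
  proof -
    obtain v where v: "v \<in> L" "v \<noteq> u" using xy by metis
    have "d u w \<le> 2" if "w \<in> V" for w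
      using that leaves[OF u, of w] star_c(2)[OF u] d_refl[of u] L(3) by (cases "w = u") auto
    then show ?thesis using ecc_eqI[of v u 2] leaves[OF u v(1)] v L(3) by simp
  qed
  have K: "ecc_kernel c c = 0" "\<And>u. u \<in> L \<Longrightarrow> ecc_kernel c u = 1" "\<And>u. u \<in> L \<Longrightarrow> ecc_kernel u c = 1"
    "\<And>u v. u \<in> L \<Longrightarrow> v \<in> L \<Longrightarrow> ecc_kernel u v = (if u = v then 0 else 2)"
    using ecc_c ecc_leaf star_c leaves d_refl c L_V by (auto simp: ecc_kernel_def)
  have at_c: "(\<Sum>v\<in>V. complex_of_real (ecc_kernel c v) * f v) = (\<Sum>v\<in>L. f v)" for f
    using K by (simp add: sum_V)
  have at_leaf: "(\<Sum>v\<in>V. complex_of_real (ecc_kernel u v) * f v) = f c + 2 * ((\<Sum>v\<in>L. f v) - f u)"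
    if u: "u \<in> L" for u f
  proof -
    have "(\<Sum>v\<in>L. complex_of_real (ecc_kernel u v) * f v) = (\<Sum>v\<in>L. 2 * f v - (if v = u then 2 * f v else 0))"
      using K(4)[OF u] by (intro sum.cong) auto
    also have "\<dots> = 2 * ((\<Sum>v\<in>L. f v) - f u)"
      using L(1) u by (simp add: sum_subtractf right_diff_distrib sum_distrib_left)
    finally show ?thesis using K u by (simp add: sum_V)
  qed
  have ball_V: "(\<forall>u\<in>V. P u) \<longleftrightarrow> P c \<and> (\<forall>u\<in>L. P u)" for P using L(3) by auto
  let ?ev = "\<lambda>f. (\<Sum>v\<in>L. f v) = b * f c \<and> (\<forall>u\<in>L. f c + 2 * ((\<Sum>v\<in>L. f v) - f u) = b * f u)"
  have ev: "kernel_eigenvalue V (\<lambda>u v. complex_of_real (ecc_kernel u v)) b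
    \<longleftrightarrow> (\<exists>f. (\<exists>v\<in>V. f v \<noteq> 0) \<and> ?ev f)"
    by (simp add: kernel_eigenvalue_def ball_V at_c at_leaf)
  show ?thesis
  proof
    assume "kernel_eigenvalue V (\<lambda>u v. complex_of_real (ecc_kernel u v)) b"
    then obtain f where f: "\<exists>v\<in>V. f v \<noteq> 0" "?ev f" using ev by blast
    show "b = -2 \<or> b * (b - 2 * (of_nat m - 1)) = of_nat m"
    proof (cases "b = -2")
      case False
      then have "b + 2 \<noteq> 0" by (metis add_eq_0_iff2 add.commute)
      \<comment> \<open>The equation at a leaf reads
        \<open>(b + 2) * f u = f c + 2 * (\<Sum>v\<in>L. f v)\<close>, whose right side is the same
        for every leaf.\<close>
      define g where "g = (f c + 2 * (\<Sum>v\<in>L. f v)) / (b + 2)"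
      have const: "f u = g" if "u \<in> L" for u
        using f(2) that \<open>b + 2 \<noteq> 0\<close> unfolding g_def by (auto simp: eq_divide_eq algebra_simps)
      have sum: "(\<Sum>v\<in>L. f v) = of_nat m * g" using const L(4) by simp
      then have 1: "of_nat m * g = b * f c" and 2: "f c + 2 * (of_nat m * g - g) = b * g"
        using f(2) xy(1) const by auto
      have "g \<noteq> 0"
      proof
        assume "g = 0"
        then have "f c = 0" using 2 by simp
        then show False using f(1) const \<open>g = 0\<close> L(3) by auto
      qed
      have "f c = (b - 2 * (of_nat m - 1)) * g" using 2 by (simp add: algebra_simps)
      then have "of_nat m * g = (b * (b - 2 * (of_nat m - 1))) * g" using 1 by simp
      then show ?thesis using \<open>g \<noteq> 0\<close> by simp
    qed simp
  next
    assume b: "b = -2 \<or> b * (b - 2 * (of_nat m - 1)) = of_nat m"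
    show "kernel_eigenvalue V (\<lambda>u v. complex_of_real (ecc_kernel u v)) b"
    proof (cases "b = -2")
      case True
      define f where "f u = (if u = x then 1 else 0) - (if u = y then 1 else 0 :: complex)" for u
      have "(\<Sum>v\<in>L. f v) = 0" "f c = 0" "f x \<noteq> 0"
        using L xy by (auto simp: f_def sum_subtractf)
      then show ?thesis unfolding ev using True xy L(3) by (intro exI[of _ f]) auto
    next
      case False
      \<comment> \<open>With value 1 on the leaves, the leaf equation dictates the value at
        \<open>c\<close>; the equation at \<open>c\<close> is then the quadratic.\<close>
      define f where "f u = (if u = c then b - 2 * (of_nat m - 1) else 1)" for u
      have "(\<Sum>v\<in>L. f v) = (\<Sum>v\<in>L. 1)" using L(2) by (intro sum.cong) (auto simp: f_def)
      then have sum: "(\<Sum>v\<in>L. f v) = of_nat m" using L(4) by simp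
      have fc: "f c = b - 2 * (of_nat m - 1)" by (simp add: f_def)
      have fL: "f u = 1" if "u \<in> L" for u using that L(2) by (auto simp: f_def)
      have "?ev f" using b False by (auto simp: sum fc fL L(4))
      moreover have "f x \<noteq> 0" using fL xy(1) by simp
      ultimately have "(\<exists>v\<in>V. f v \<noteq> 0) \<and> ?ev f" using L_V xy(1) by blast
      then show ?thesis unfolding ev by blast
    qed
  qed
qed

lemma star_three_eigenvalues:
  assumes c: "c \<in> V" and star: "\<And>u. u \<in> V - {c} \<Longrightarrow> d c u = 1" and "card V \<ge> 3"
  shows three_ecc_eigenvalues
proof -
  define m where "m = card V - 1"
  have m: "card V = m + 1" "m \<ge> 2" using assms(3) by (auto simp: m_def)
  \<comment> \<open>\<open>r\<close> is the square root of a quarter of the discriminant, positive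
    because \<open>m \<ge> 2\<close>, so the two roots \<open>p\<close> and \<open>q\<close>
    differ.\<close>
  define r where "r = sqrt ((real m - 1)\<^sup>2 + real m)"
  have r2: "r\<^sup>2 = (real m - 1)\<^sup>2 + real m" by (simp add: r_def)
  have "r > 0" using m by (auto simp: r_def intro!: real_sqrt_gt_zero add_nonneg_pos)
  define p q where "p = real m - 1 + r" and "q = real m - 1 - r"
  have factor: "z * (z - 2 * (of_nat m - 1)) = of_nat m \<longleftrightarrow> z = of_real p \<or> z = of_real q" for z :: complex
  proof -
    have "p + q = 2 * (real m - 1)" "p * q = - real m"
      using r2 by (simp_all add: p_def q_def power2_eq_square algebra_simps)
    then have "complex_of_real (p + q) = of_real (2 * (real m - 1))" "complex_of_real (p * q) = of_real (- real m)"
      by simp_all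
    then have sum: "complex_of_real p + of_real q = 2 * (of_nat m - 1)"
      and prod: "complex_of_real p * of_real q = - of_nat m" by simp_all
    have "(z - of_real p) * (z - of_real q) = z * (z - (of_real p + of_real q)) + of_real p * of_real q"
      by (simp add: algebra_simps)
    then have "z * (z - 2 * (of_nat m - 1)) - of_nat m = (z - of_real p) * (z - of_real q)"
      by (simp add: sum prod)
    then show ?thesis by (metis eq_iff_diff_eq_0 mult_eq_0_iff)
  qed
  \<comment> \<open>At -2 the left side equals \<open>4 * m\<close>, so -2 is not a root of the
    quadratic and is a third eigenvalue.\<close>
  have neq: "(-2 :: complex) * (-2 - 2 * (of_nat m - 1)) \<noteq> of_nat m"
  proof
    assume "(-2 :: complex) * (-2 - 2 * (of_nat m - 1)) = of_nat m"
    then have "complex_of_real (4 * real m) = of_real (real m)" by (simp add: algebra_simps)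
    then show False using m(2) by (simp only: of_real_eq_iff)
  qed
  have "Collect (kernel_eigenvalue V (\<lambda>u v. complex_of_real (ecc_kernel u v))) = {-2, of_real p, of_real q}"
    using star_eigenvalue_iff[OF c star m] factor by auto
  moreover have "p \<noteq> q" using \<open>r > 0\<close> by (simp add: p_def q_def)
  moreover have "-2 \<noteq> complex_of_real p" "-2 \<noteq> complex_of_real q" using neq factor by metis+
  ultimately show ?thesis by simp
qed

end

section \<open>Walks, cycles and distances in undirected trees\<close>

lemma (in wf_digraph) awalk_rev:
  assumes "symmetric G" "awalk u p v"
  shows "\<exists>q. awalk v q u \<and> length q = length p"
  using assms(2)
proof (induction p arbitrary: u)
  case Nil
  then show ?case by (auto simp: awalk_Nil_iff)
next
  case (Cons e p)
  then have e: "e \<in> arcs G" "u = tail G e" "awalk (head G e) p v" by (auto simp: awalk_Cons_iff)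
  obtain f where f: "f \<in> arcs G" "tail G f = head G e" "head G f = tail G e"
    using assms(1) e(1) unfolding symmetric_conv by metis
  obtain q where "awalk v q (head G e)" "length q = length p" using Cons.IH[OF e(3)] by blast
  moreover have "awalk (head G e) [f] u" using f e by (simp add: awalk_simps)
  ultimately have "awalk v (q @ [f]) u \<and> length (q @ [f]) = length (e # p)"
    by (metis awalk_appendI length_append length_Cons list.size(3) add_Suc_right add_0_right)
  then show ?case by blast
qed

text \<open>Ensures that a walk avoiding a vertex still avoids it after being shortened to a
  path.\<close>

lemma (in wf_digraph) awalk_to_apath_verts_subset:
  assumes "awalk u p v"
  shows "set (awalk_verts u (awalk_to_apath p)) \<subseteq> set (awalk_verts u p)"
  using awalk_to_apath_subset[OF assms] set_awalk_verts[OF assms]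
    set_awalk_verts[OF awalkI_apath[OF apath_awalk_to_apath[OF assms]]]
  by fastforce

text \<open>Shorten the walk to a path and close it up through \<open>u\<close>. The path has at
  least one arc because its ends differ, so the result is longer than a pair of opposite
  arcs.\<close>

lemma (in wf_digraph) cycle_through_vertex:
  assumes "e \<in> arcs G" "f \<in> arcs G" "tail G e = u" "head G f = u"
    and p: "awalk (head G e) p (tail G f)" "u \<notin> set (awalk_verts (head G e) p)"
    and "head G e \<noteq> tail G f"
  shows "\<exists>c. cycle c \<and> 3 \<le> length c"
proof -
  let ?q = "awalk_to_apath p"
  have q: "awalk (head G e) ?q (tail G f)" "distinct (awalk_verts (head G e) ?q)"
    using apath_awalk_to_apath[OF p(1)] by (auto simp: apath_def)
  have u: "u \<notin> set (awalk_verts (head G e) ?q)" using awalk_to_apath_verts_subset[OF p(1)] p(2) by blast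
  have "?q \<noteq> []" using q(1) assms(7) by (auto simp: awalk_Nil_iff)
  have qf: "awalk (head G e) (?q @ [f]) u"
    using q(1) assms by (intro awalk_appendI[OF q(1)]) (auto simp: awalk_simps)
  then have "awalk u (e # ?q @ [f]) u" using assms(1,3) by (simp add: awalk_Cons_iff del: awalk_append_iff)
  moreover have "awalk_verts (head G e) (?q @ [f]) = awalk_verts (head G e) ?q @ [u]"
    using awalk_verts_append[OF qf] assms(4) by simp
  then have "distinct (tl (awalk_verts u (e # ?q @ [f])))" using q(2) u by simp
  ultimately have "cycle (e # ?q @ [f])" unfolding cycle_def by blast
  moreover have "3 \<le> length (e # ?q @ [f])" using \<open>?q \<noteq> []\<close> by (cases ?q) auto
  ultimately show ?thesis by blast
qed

text \<open>The natural number behind \<open>gdist\<close>, so that the tree arguments can be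
  carried out in \<open>nat\<close>.\<close>

definition walk_dist :: "('a, 'b) pre_digraph \<Rightarrow> 'a \<Rightarrow> 'a \<Rightarrow> nat" where
  "walk_dist G u v = (LEAST k. \<exists>q. pre_digraph.awalk G u q v \<and> length q = k)"

lemma (in wf_digraph) walk_dist_le: "awalk u p v \<Longrightarrow> walk_dist G u v \<le> length p"
  unfolding walk_dist_def by (rule Least_le) blast

lemma (in wf_digraph) walk_dist_awalk:
  assumes "awalk u p v"
  obtains q where "awalk u q v" "length q = walk_dist G u v"
  using LeastI[of "\<lambda>k. \<exists>q. awalk u q v \<and> length q = k" "length p"] assms
  unfolding walk_dist_def by blast

lemma undirected_tree_awalk:
  assumes "undirected_tree T" "u \<in> verts T" "v \<in> verts T"
  shows "\<exists>p. pre_digraph.awalk T u p v"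
proof -
  interpret graph T using assms(1) by (simp add: undirected_tree_def)
  have "strongly_connected T"
    using assms(1) symmetric_connected_imp_strongly_connected[OF sym_arcs]
    by (simp add: undirected_tree_def)
  then show ?thesis using assms(2,3) by (auto simp: strongly_connected_def reachable_awalk)
qed

text \<open>Acyclicity enters through \<open>avoid\<close>: neighbours of \<open>u\<close> joined by
  a walk that misses \<open>u\<close> must coincide. Both acyclicity axioms follow by concatenating
  two shortest walks at \<open>v\<close>.\<close>

lemma undirected_tree_metric:
  assumes "undirected_tree T"
  shows "tree_metric (verts T) (walk_dist T)"
proof -
  interpret graph T using assms by (simp add: undirected_tree_def)
  let ?d = "walk_dist T"
  have acyclic: "\<not> (\<exists>c. cycle c \<and> 3 \<le> length c)"
    using assms by (simp add: undirected_tree_def)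
  have geodesic: "\<exists>p. awalk u p v \<and> length p = ?d u v" if "u \<in> verts T" "v \<in> verts T" for u v
    using undirected_tree_awalk[OF assms that] walk_dist_awalk by metis
  have rev: "\<exists>q. awalk v q u \<and> length q = length p" if "awalk u p v" for u p v
    using awalk_rev[OF sym_arcs that] .
  have sym: "?d u v = ?d v u" if "u \<in> verts T" "v \<in> verts T" for u v
    using geodesic[of u v] geodesic[of v u] that rev walk_dist_le by (metis antisym)
  have triangle: "?d u w \<le> ?d u v + ?d v w" if uvw: "u \<in> verts T" "v \<in> verts T" "w \<in> verts T" for u v w
  proof -
    obtain p q where p: "awalk u p v" "length p = ?d u v" and q: "awalk v q w" "length q = ?d v w"
      using geodesic[OF uvw(1,2)] geodesic[OF uvw(2,3)] by blast
    show ?thesis using p(2) q(2) walk_dist_le[OF awalk_appendI[OF p(1) q(1)]] by simp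
  qed
  have eq_0: "?d u v = 0 \<longleftrightarrow> u = v" if "u \<in> verts T" "v \<in> verts T" for u v
    using geodesic[OF that] walk_dist_le[of u "[]" v] that by (auto simp: awalk_Nil_iff)
  have arc_dist: "?d (tail T e) (head T e) = 1" if "e \<in> arcs T" for e
    using walk_dist_le[OF arc_implies_awalk[OF that]] eq_0[of "tail T e" "head T e"] no_loops[OF that] that
    by (simp add: le_Suc_eq)
  have adj: "\<exists>e\<in>arcs T. tail T e = u \<and> head T e = w" if "u \<in> verts T" "w \<in> verts T" "?d u w = 1" for u w
  proof -
    from geodesic[OF that(1,2)] that(3) obtain p where "awalk u p w" "length p = 1" by auto
    then show ?thesis by (cases p) (auto simp: awalk_simps)
  qed
  have on_geodesic: "?d u z + ?d z v = ?d u v"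
    if p: "awalk u p v" "length p = ?d u v" "z \<in> set (awalk_verts u p)" for u v p z
  proof -
    obtain q r where "p = q @ r" "awalk u q z" "awalk z r v" using awalk_decomp[OF p(1,3)] by blast
    then show ?thesis
      using walk_dist_le[of u q z] walk_dist_le[of z r v] p(2) triangle[of u z v]
        awalk_hd_in_verts[of u q z] awalk_hd_in_verts[of z r v] awalk_last_in_verts[of z r v]
      by simp
  qed
  have avoid: "w = w'" if walk: "u \<in> verts T" "w \<in> verts T" "w' \<in> verts T" "?d u w = 1" "?d u w' = 1"
    "awalk w p w'" "u \<notin> set (awalk_verts w p)" for u w w' p
  proof (rule ccontr)
    assume "w \<noteq> w'"
    obtain e where "e \<in> arcs T" "tail T e = u" "head T e = w" using adj[of u w] walk by blast
    moreover obtain f where "f \<in> arcs T" "tail T f = w'" "head T f = u"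
      using adj[of w' u] sym[of u w'] walk by auto
    ultimately show False
      using cycle_through_vertex[of e f u p] acyclic walk \<open>w \<noteq> w'\<close> by auto
  qed
  have step: "\<exists>w\<in>verts T. ?d u w = 1 \<and> ?d u v = Suc (?d w v)"
    if uv: "u \<in> verts T" "v \<in> verts T" "u \<noteq> v" for u v
  proof -
    obtain p where p: "awalk u p v" "length p = ?d u v" using geodesic uv by blast
    then obtain e q where "p = e # q" using eq_0[OF uv(1,2)] uv(3) by (cases p) auto
    then have e: "e \<in> arcs T" "tail T e = u" "awalk (head T e) q v" using p by (auto simp: awalk_Cons_iff)
    have "?d u v \<le> ?d u (head T e) + ?d (head T e) v" using triangle uv e by simp
    then have "?d u (head T e) = 1 \<and> ?d u v = Suc (?d (head T e) v)"
      using arc_dist[OF e(1)] e walk_dist_le[OF e(3)] p(2) \<open>p = e # q\<close> by simp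
    then show ?thesis using e(1) by auto
  qed
  show ?thesis
  proof
    fix u v w assume uvw: "u \<in> verts T" "v \<in> verts T" "w \<in> verts T" "?d u w = 1"
    show "?d u v \<noteq> ?d w v"
    proof
      \<comment> \<open>The neighbour \<open>x\<close> of \<open>u\<close> towards \<open>v\<close>
        reaches \<open>w\<close> via \<open>v\<close> without meeting \<open>u\<close>, so
        \<open>x = w\<close>; but \<open>x\<close> is strictly nearer to \<open>v\<close> than
        \<open>u\<close> is, and \<open>w\<close> is not.\<close>
      assume eq: "?d u v = ?d w v"
      have "u \<noteq> w" using uvw eq_0 by force
      then have "u \<noteq> v" using eq eq_0 uvw by metis
      then obtain x where x: "x \<in> verts T" "?d u x = 1" "?d u v = Suc (?d x v)" using step uvw by blast
      obtain p where p: "awalk x p v" "length p = ?d x v" using geodesic x uvw by blast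
      obtain q where q: "awalk v q w" "length q = ?d v w" using geodesic uvw by blast
      have "u \<notin> set (awalk_verts x p)"
      proof
        assume "u \<in> set (awalk_verts x p)"
        from on_geodesic[OF p this] x show False by simp
      qed
      moreover have "u \<notin> set (awalk_verts v q)"
      proof
        assume "u \<in> set (awalk_verts v q)"
        from on_geodesic[OF q this] sym[of v u] sym[of v w] uvw eq show False by simp
      qed
      ultimately have "x = w"
        using avoid[of u x w "p @ q"] awalk_appendI[OF p(1) q(1)] set_awalk_verts_append[OF p(1) q(1)] x uvw
        by blast
      then show False using x eq by simp
    qed
  next
    fix u v w w'
    assume V: "u \<in> verts T" "v \<in> verts T" "w \<in> verts T" "w' \<in> verts T"
      and *: "?d u w = 1" "?d u w' = 1" "?d u v = Suc (?d w v)" "?d u v = Suc (?d w' v)"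
    \<comment> \<open>Shortest walks from \<open>w\<close> to \<open>v\<close> and from
      \<open>v\<close> to \<open>w'\<close> miss \<open>u\<close>, since \<open>u\<close> is farther
      from \<open>v\<close> than either of their other ends.\<close>
    obtain p where p: "awalk w p v" "length p = ?d w v" using geodesic V by blast
    obtain q where q: "awalk v q w'" "length q = ?d v w'" using geodesic V by blast
    have "u \<notin> set (awalk_verts w p)"
    proof
      assume "u \<in> set (awalk_verts w p)"
      from on_geodesic[OF p this] * show False by simp
    qed
    moreover have "u \<notin> set (awalk_verts v q)"
    proof
      assume "u \<in> set (awalk_verts v q)"
      from on_geodesic[OF q this] sym[of v u] sym[of v w'] V * show False by simp
    qed
    ultimately show "w = w'"
      using avoid[of u w w' "p @ q"] awalk_appendI[OF p(1) q(1)] set_awalk_verts_append[OF p(1) q(1)] V *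
      by blast
  qed (use sym triangle eq_0 step in auto)
qed

section \<open>Transfer to the eccentricity matrix and the star graph\<close>

lemma gdist_eq_walk_dist:
  assumes "undirected_tree T" "u \<in> verts T" "v \<in> verts T"
  shows "gdist T u v = real (walk_dist T u v)"
proof -
  interpret graph T using assms by (simp add: undirected_tree_def)
  obtain p where "awalk u p v" using undirected_tree_awalk[OF assms] by blast
  then show ?thesis using gdist_eq_Least[OF wf_digraph] by (simp add: walk_dist_def)
qed

theorem theorem4p9:
  fixes T :: "('a, 'b) pre_digraph" and vs :: "'a list" and n :: nat
  assumes "undirected_tree T"
    and "card (verts T) = n" and "n \<ge> 4"
    and "distinct vs" and "set vs = verts T"
  shows "card (spectrum (map_mat complex_of_real (eccentricity_matrix T vs))) = 3
    \<longleftrightarrow> K\<^bsub>1,n - 1\<^esub> T"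
proof -
  interpret graph T using assms(1) by (simp add: undirected_tree_def)
  interpret tree_metric "verts T" "walk_dist T" by (rule undirected_tree_metric[OF assms(1)])
  note gdist = gdist_eq_walk_dist[OF assms(1)]
  have ecc: "eccentricity T u = real (ecc u)" if "u \<in> verts T" for u
  proof -
    have "gdist T u ` verts T = real ` (walk_dist T u ` verts T)"
      using gdist[OF that] by (auto simp: image_image)
    then show ?thesis
      using that mono_Max_commute[of real "walk_dist T u ` verts T"] by (fastforce simp: eccentricity_def ecc_def mono_def)
  qed
  have vs: "vs ! i \<in> verts T" if "i < length vs" for i
    using nth_mem[OF that] unfolding assms(5) .
  have "map_mat complex_of_real (eccentricity_matrix T vs)
    = mat (length vs) (length vs) (\<lambda>(i, j). complex_of_real (ecc_kernel (vs ! i) (vs ! j)))"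
    by (rule eq_matI)
      (simp_all add: eccentricity_matrix_def Let_def gdist[OF vs vs] ecc[OF vs] ecc_kernel_def
        flip: of_nat_min)
  then have "spectrum (map_mat complex_of_real (eccentricity_matrix T vs))
    = Collect (kernel_eigenvalue (verts T) (\<lambda>u v. complex_of_real (ecc_kernel u v)))"
    using eigenvalue_mat_iff_kernel_eigenvalue[OF assms(4), of "\<lambda>u v. complex_of_real (ecc_kernel u v)"]
    by (simp add: spectrum_def assms(5) cong: Collect_cong)
  moreover have "three_ecc_eigenvalues \<longleftrightarrow> (\<exists>c\<in>verts T. \<forall>u\<in>verts T - {c}. walk_dist T c u = 1)"
    using three_eigenvalues_imp_star star_three_eigenvalues assms(2,3) by auto
  moreover have "\<dots> \<longleftrightarrow> K\<^bsub>1,n - 1\<^esub> T"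
  proof -
    \<comment> \<open>This turns the star condition into one about distances.\<close>
    have ends: "(u, v) \<in> arcs_ends T \<longleftrightarrow> u \<in> verts T \<and> v \<in> verts T \<and> walk_dist T u v = 1" for u v
    proof
      assume "(u, v) \<in> arcs_ends T"
      then obtain e where e: "e \<in> arcs T" "u = tail T e" "v = head T e"
        by (auto simp: arcs_ends_def arc_to_ends_def)
      then show "u \<in> verts T \<and> v \<in> verts T \<and> walk_dist T u v = 1"
        using walk_dist_le[OF arc_implies_awalk[OF e(1)]] d_eq_0[of u v] no_loops[OF e(1)]
        by (simp add: le_Suc_eq)
    next
      assume uv: "u \<in> verts T \<and> v \<in> verts T \<and> walk_dist T u v = 1"
      obtain p where "awalk u p v" "length p = 1"
        using undirected_tree_awalk[OF assms(1), of u v] walk_dist_awalk uv by metis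
      then show "(u, v) \<in> arcs_ends T"
        by (cases p) (auto simp: awalk_simps arcs_ends_def arc_to_ends_def)
    qed
    show ?thesis
    proof
      assume "\<exists>c\<in>verts T. \<forall>u\<in>verts T - {c}. walk_dist T c u = 1"
      then obtain c where c: "c \<in> verts T" "\<And>u. u \<in> verts T - {c} \<Longrightarrow> walk_dist T c u = 1" by blast
      have dc: "walk_dist T u c = 1" if "u \<in> verts T - {c}" for u
        using c(2)[OF that] d_sym[OF c(1), of u] that by simp
      \<comment> \<open>Two vertices other than \<open>c\<close> are both at distance 1 from
        \<open>c\<close>, so \<open>d_adj_neq\<close> forbids an arc between them.\<close>
      have leaf: "v = c" if uv: "u \<in> verts T - {c}" "v \<in> verts T" "walk_dist T u v = 1" for u v
        using d_adj_neq[of u c v] dc[of u] dc[of v] c(1) uv by auto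
      have "(u, v) \<in> arcs_ends T \<longleftrightarrow> (u, v) \<in> {c} \<times> (verts T - {c}) \<union> (verts T - {c}) \<times> {c}" for u v
        using c dc leaf[of u v] d_refl[OF c(1)] unfolding ends by auto
      then have "arcs_ends T = {c} \<times> (verts T - {c}) \<union> (verts T - {c}) \<times> {c}" by auto
      moreover have "graph T" using assms(1) by (simp add: undirected_tree_def)
      moreover have "verts T = {c} \<union> (verts T - {c})" using c(1) by blast
      moreover have "card (verts T - {c}) = n - 1" using c(1) assms(2) by simp
      ultimately show "K\<^bsub>1,n - 1\<^esub> T"
        unfolding complete_bipartite_digraph_def
        by (intro conjI exI[of _ "{c}"] exI[of _ "verts T - {c}"]) simp_all
    next
      assume "K\<^bsub>1,n - 1\<^esub> T"
      then obtain U W where UW: "verts T = U \<union> W" "U \<inter> W = {}" "card U = 1"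
        "arcs_ends T = U \<times> W \<union> W \<times> U"
        unfolding complete_bipartite_digraph_def by blast
      then obtain c where "U = {c}" by (metis card_1_singletonE)
      then have "c \<in> verts T \<and> (\<forall>u\<in>verts T - {c}. walk_dist T c u = 1)"
        using UW ends by auto
      then show "\<exists>c\<in>verts T. \<forall>u\<in>verts T - {c}. walk_dist T c u = 1" by blast
    qed
  qed
  ultimately show ?thesis by simp
qed

end
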